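(* Let $\mathbb{K}$ be a field of characteristic $0$, let $R=\mathbb{K}[x,y,z]$, and let $\mathcal{A}$ be an arrangement of $n$ distinct lines in $\mathbb{P}^2_{\mathbb{K}}$ with defining linear forms $\ell_1,\ldots,\ell_n\in R$ such that $\langle \ell_1,\ldots,\ell_n\rangle$ has height $3$ (i.e. $\mathcal{A}$ has rank $3$). Let $$I=\langle \ell_2\ell_3\cdots\ell_n,\ \ell_1\ell_3\cdots\ell_n,\ \ldots,\ \ell_1\ell_2\cdots\ell_{n-1}\rangle\subset R$$ be the ideal generated by all $(n-1)$-fold products of these linear forms, and let $M=\langle x,y,z\rangle$. Then for every integer $r\geq 1$: (1) $I^{(2r-1)}\subseteq M^{r-1}\cdot I^r$. (2) $I^{(2r)}\subseteq M^{r}\cdot I^r$.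
   Context: Let $P_1,\ldots,P_s$ be the singular points of $\mathcal{A}$, i.e. the points of $\mathbb{P}^2_{\mathbb{K}}$ lying on at least two lines of $\mathcal{A}$; let $n_j$ be the number of lines of $\mathcal{A}$ passing through $P_j$, and let $I(P_j)\subset R$ be the ideal generated by all homogeneous polynomials vanishing at $P_j$. It is known that $I=\bigcap_{j=1}^s I(P_j)^{n_j-1}$, so $I$ is a fat points ideal. Its $m$-th symbolic power is $I^{(m)}=\bigcap_{j=1}^s I(P_j)^{m(n_j-1)}$, while $I^r$ and $M^r$ denote ordinary powers ($M^0=R$). *)

theory Defs
  imports
    "HOL-Algebra.Algebraic_Closure_Type"
    "HOL-Algebra.Ideal_Product"
    "HOL-Analysis.Finite_Cartesian_Product"
    "HOL-Library.Extended_Nat"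
    "HOL-Library.Numeral_Type"
    "HOL-Library.Poly_Mapping"
begin

text \<open>
  The elements of \<open>K[x,y,z]\<close> are the finitely supported maps from monomials to coefficients, a
  monomial being a map from the three variables (indexed by the type \<^typ>\<open>3\<close>) to exponents.
\<close>

type_synonym 'a poly3 = "(3 \<Rightarrow>\<^sub>0 nat) \<Rightarrow>\<^sub>0 'a"

abbreviation polyR :: "'a::field poly3 ring"
  where "polyR \<equiv> ring_of_type_algebra"

definition Var :: "3 \<Rightarrow> 'a::field poly3"
  where "Var i = Poly_Mapping.single (Poly_Mapping.single i 1) 1"

definition mon_degree :: "(3 \<Rightarrow>\<^sub>0 nat) \<Rightarrow> nat"
  where "mon_degree m = (\<Sum>i\<in>UNIV. Poly_Mapping.lookup m i)"

definition homogeneous :: "nat \<Rightarrow> 'a::field poly3 \<Rightarrow> bool"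
  where "homogeneous d f \<longleftrightarrow> (\<forall>m\<in>Poly_Mapping.keys f. mon_degree m = d)"

definition poly_eval :: "'a::field poly3 \<Rightarrow> 'a ^ 3 \<Rightarrow> 'a"
  where "poly_eval f v =
    (\<Sum>m\<in>Poly_Mapping.keys f.
       Poly_Mapping.lookup f m * (\<Prod>i\<in>UNIV. v $ i ^ Poly_Mapping.lookup m i))"

text \<open>
  A point of the projective plane is the set of all its homogeneous coordinate vectors.
\<close>

type_synonym 'a point = "('a ^ 3) set"

definition proj_plane :: "'a::field point set"
  where "proj_plane = {{c *s v | c. c \<noteq> 0} | v. v \<noteq> 0}"

text \<open>Only meaningful for homogeneous \<open>f\<close>, where a single representative of \<open>P\<close> decides it.\<close>

definition vanishes_at :: "'a::field poly3 \<Rightarrow> 'a point \<Rightarrow> bool"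
  where "vanishes_at f P \<longleftrightarrow> (\<forall>v\<in>P. poly_eval f v = 0)"

definition zero_locus :: "'a::field poly3 \<Rightarrow> 'a point set"
  where "zero_locus f = {P \<in> proj_plane. vanishes_at f P}"

text \<open>An arrangement \<open>A\<close> is a set of lines, each line being given by the set of its points.\<close>

definition mult_at :: "'a::field point set set \<Rightarrow> 'a point \<Rightarrow> nat"
  where "mult_at A P = card {L \<in> A. P \<in> L}"

definition singular_points :: "'a::field point set set \<Rightarrow> 'a point set"
  where "singular_points A = {P \<in> proj_plane. mult_at A P \<ge> 2}"

definition point_ideal :: "'a::field point \<Rightarrow> 'a poly3 set"
  where "point_ideal P = Idl\<^bsub>polyR\<^esub> {f. (\<exists>d. homogeneous d f) \<and> vanishes_at f P}"

text \<open>
  \<open>R\<close>-ideals under \<^const>\<open>ideal_prod\<close> form the multiplicative structure of \<^const>\<open>ideals_set\<close>,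
  whose unit is the whole ring, so the zeroth power of an ideal is the whole ring.
\<close>

abbreviation ideal_power :: "'a::field poly3 set \<Rightarrow> nat \<Rightarrow> 'a poly3 set"
  where "ideal_power J r \<equiv> J [^]\<^bsub>ideals_set polyR\<^esub> r"

text \<open>
  The ideal generated by the \<open>(n - 1)\<close>-fold products of the defining forms of \<open>A\<close> is the fat points
  ideal with multiplicity \<open>mult_at A P - 1\<close> at each singular point \<open>P\<close>; the \<open>m\<close>-th symbolic power
  of a fat points ideal is obtained by multiplying all multiplicities by \<open>m\<close>.
\<close>

definition symbolic_power :: "'a::field point set set \<Rightarrow> nat \<Rightarrow> 'a poly3 set"
  where "symbolic_power A m =
    (\<Inter>P\<in>singular_points A. ideal_power (point_ideal P) (m * (mult_at A P - 1)))"

definition fold_product_ideal :: "nat \<Rightarrow> (nat \<Rightarrow> 'a::field poly3) \<Rightarrow> 'a poly3 set"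
  where "fold_product_ideal n l = Idl\<^bsub>polyR\<^esub> ((\<lambda>i. \<Prod>j\<in>{1..n} - {i}. l j) ` {1..n})"

definition irrelevant_ideal :: "'a::field poly3 set"
  where "irrelevant_ideal = Idl\<^bsub>polyR\<^esub> (range Var)"

definition prime_height :: "('r, 'm) ring_scheme \<Rightarrow> 'r set \<Rightarrow> enat"
  where "prime_height R P = Sup {enat k | k. \<exists>C :: nat \<Rightarrow> 'r set.
    (\<forall>i\<le>k. primeideal (C i) R) \<and> (\<forall>i<k. C i \<subset> C (Suc i)) \<and> C k = P}"

definition ideal_height :: "('r, 'm) ring_scheme \<Rightarrow> 'r set \<Rightarrow> enat"
  where "ideal_height R J = Inf (prime_height R ` {P. primeideal P R \<and> J \<subseteq> P})"

end

(*
  Let n = |A| and r >= 1. A form f of degree r(n-1) + d that vanishes to order r(n_P - 1) at every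
  point P lies in M^d I^r. This is proved by induction on the number of lines. Remove a line l, let
  F be the product of the remaining lines and I' their ideal, so that F and l I' lie in I.
  Restricted to l, f is divisible by F^r; subtract a multiple of F^r, divide by l, and repeat. After
  k divisions the restriction is divisible by F^(r-k) times the product of the forms of the points P
  on l to the powers k(n_P - 2), and Lagrange interpolation on l shows that every such form of the
  given degree is the restriction of an element of F^(r-k) I'^k M^d. After r divisions the quotient
  satisfies the hypothesis for the smaller arrangement.

  It remains to bound the degree of a form f in I^(m) from below. If deg f < m(n-1) then f vanishes
  on every line by Bezout; dividing by all n lines leaves an element of I^(m-2). Hence the degree is
  at least rn for m = 2r and at least rn - 1 for m = 2r - 1, which leaves an excess d >= r and
  d >= r - 1, respectively, over r(n-1).
*)
theory Submission
  imports Defs "HOL-Analysis.Cartesian_Space"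
begin

unbundle no fps_syntax

text \<open>The repeated division closes up because a lift supplies exactly what is required. At a
  point of l on p >= 1 of the other lines, f must still have order r p - k after k divisions, and r
  p - k = (r - k) p + k (p - 1) is the sum of the orders that F^(r-k) and I'^k provide there.
  Removing these factors leaves a polynomial of degree at most k (b - 1) + d, where b is the number
  of such points, and b - 1 is the degree in which interpolation at b points yields every form. The
  other d degrees are free, so they can be realised in M^d. The step from m to m - 2 also has a
  local reason: dividing by all lines costs order n_P at P, and n_P <= 2 (n_P - 1) at every singular
  point. Characteristic 0 provides infinitely many points on each line, hence one off all other
  lines; placed at infinity, it makes all intersections roots of a univariate polynomial. Height 3
  provides n >= 2, which gives 2r(n - 1) >= rn.\<close>

locale comm_ring_morphism =
  fixes h :: "'b::comm_ring_1 \<Rightarrow> 'c::comm_ring_1"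
  assumes add: "h (x + y) = h x + h y"
    and mult: "h (x * y) = h x * h y"
    and one: "h 1 = 1"
begin

lemma zero: "h 0 = 0"
  using add[of 0 0] by simp

lemma uminus: "h (- x) = - h x"
  using add[of x "- x"] by (simp add: zero minus_unique)

lemma diff: "h (x - y) = h x - h y"
  using add[of x "- y"] by (simp add: uminus)

lemma sum: "h (sum f A) = (\<Sum>a\<in>A. h (f a))"
  by (induction A rule: infinite_finite_induct) (auto simp: zero add)

lemma prod: "h (prod f A) = (\<Prod>a\<in>A. h (f a))"
  by (induction A rule: infinite_finite_induct) (auto simp: one mult)

lemma power: "h (x ^ k) = h x ^ k"
  by (induction k) (auto simp: one mult)

lemma dvd: "x dvd y \<Longrightarrow> h x dvd h y"
  by (auto simp: dvd_def mult)

lemma map_poly: "comm_ring_morphism (map_poly h)"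
proof
  fix p q :: "'b poly"
  show "map_poly h (p + q) = map_poly h p + map_poly h q"
    by (rule poly_eqI) (simp add: coeff_map_poly zero add)
  show "map_poly h (p * q) = map_poly h p * map_poly h q"
    by (rule poly_eqI) (simp add: coeff_map_poly coeff_mult zero sum mult)
  show "map_poly h 1 = 1"
    by (simp add: one)
qed

end

lemma comm_ring_morphism_comp:
  "comm_ring_morphism g \<Longrightarrow> comm_ring_morphism h \<Longrightarrow> comm_ring_morphism (\<lambda>x. g (h x))"
  unfolding comm_ring_morphism_def by auto

lemma comm_ring_morphism_poly: "comm_ring_morphism (\<lambda>p. poly p x)"
  by standard auto

lemma comm_ring_morphism_pcompose: "comm_ring_morphism (\<lambda>p. pcompose p q)"
  by standard (auto simp: pcompose_add pcompose_mult one_pCons pcompose_pCons)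

lemma comm_ring_morphism_const: "comm_ring_morphism (\<lambda>c. [:c:])"
  by standard (auto simp: one_pCons)

lemma comm_ring_morphism_id: "comm_ring_morphism (\<lambda>x. x)"
  by standard auto

lemma comm_ring_morphism_single: "comm_ring_morphism (\<lambda>c::'a::field. Poly_Mapping.single 0 c :: 'a poly3)"
  by standard (auto simp: single_add mult_single)

subsection \<open>Substitution homomorphisms\<close>

text \<open>The substitution determined by \<open>c\<close> on coefficients and \<open>b\<close> on
  variables. Evaluation, grading, Taylor expansion, restriction to a line and projection along a
  line are all instances.\<close>

definition psub :: "('a::comm_ring_1 \<Rightarrow> 'b::comm_ring_1) \<Rightarrow> (3 \<Rightarrow> 'b) \<Rightarrow> 'a poly3 \<Rightarrow> 'b"
  where "psub c b f = (\<Sum>m\<in>Poly_Mapping.keys f.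
    c (Poly_Mapping.lookup f m) * (\<Prod>i\<in>UNIV. b i ^ Poly_Mapping.lookup m i))"

lemma poly_eval_eq_psub: "poly_eval f v = psub (\<lambda>x. x) (\<lambda>i. v $ i) f"
  by (simp add: poly_eval_def psub_def)

lemma poly3_sum_singles:
  fixes f :: "'a::comm_ring_1 poly3"
  shows "f = (\<Sum>m\<in>Poly_Mapping.keys f. Poly_Mapping.single m (Poly_Mapping.lookup f m))"
  by (rule poly_mapping_eqI)
     (auto simp: lookup_sum lookup_single when_def sum.delta' in_keys_iff)

lemma poly3_sum_induct [case_names single add]:
  fixes f :: "'a::comm_ring_1 poly3"
  assumes "\<And>m a. P (Poly_Mapping.single m a)" "\<And>f g. P f \<Longrightarrow> P g \<Longrightarrow> P (f + g)"
  shows "P f"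
proof -
  have "P (\<Sum>m\<in>A. Poly_Mapping.single m (Poly_Mapping.lookup f m))" if "finite A" for A
    using that
  proof induction
    case empty
    show ?case using assms(1)[of 0 0] by simp
  next
    case (insert m A)
    then show ?case using assms by simp
  qed
  then show ?thesis by (subst poly3_sum_singles) simp
qed

context comm_ring_morphism
begin

lemma psub_superset:
  assumes "finite A" "Poly_Mapping.keys f \<subseteq> A"
  shows "psub h b f = (\<Sum>m\<in>A. h (Poly_Mapping.lookup f m) * (\<Prod>i\<in>UNIV. b i ^ Poly_Mapping.lookup m i))"
  unfolding psub_def using assms
  by (intro sum.mono_neutral_left) (auto simp: in_keys_iff zero)

lemma psub_single: "psub h b (Poly_Mapping.single m a) = h a * (\<Prod>i\<in>UNIV. b i ^ Poly_Mapping.lookup m i)"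
  by (subst psub_superset[of "{m}"]) auto

lemma psub_add: "psub h b (f + g) = psub h b f + psub h b g"
proof -
  let ?A = "Poly_Mapping.keys f \<union> Poly_Mapping.keys g"
  have "Poly_Mapping.keys (f + g) \<subseteq> ?A" by (rule keys_add)
  then show ?thesis
    by (subst (1 2 3) psub_superset[of ?A]) (auto simp: lookup_add add algebra_simps sum.distrib)
qed

end

lemma psub_morphism:
  fixes c :: "'a::comm_ring_1 \<Rightarrow> 'b::comm_ring_1"
  assumes "comm_ring_morphism c"
  shows "comm_ring_morphism (psub c b)"
proof -
  interpret comm_ring_morphism c by fact
  have *: "psub c b (Poly_Mapping.single m a * g) = psub c b (Poly_Mapping.single m a) * psub c b g" for m a g
  proof (induction g rule: poly3_sum_induct)
    case (single m' a')
    then show ?case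
      by (simp add: mult_single psub_single lookup_add power_add prod.distrib mult algebra_simps)
  qed (simp add: psub_add distrib_left)
  show ?thesis
  proof
    show "psub c b (f * g) = psub c b f * psub c b g" for f g
      by (induction f rule: poly3_sum_induct) (simp_all add: * psub_add distrib_right)
    show "psub c b 1 = 1"
      using psub_single[of b 0 1] by (simp add: one flip: single_one)
  qed (rule psub_add)
qed

lemma psub_Var: "comm_ring_morphism c \<Longrightarrow> psub c b (Var i) = b i"
proof -
  assume "comm_ring_morphism c"
  then interpret comm_ring_morphism c .
  have "(\<Prod>j\<in>UNIV. b j ^ Poly_Mapping.lookup (Poly_Mapping.single i (1::nat)) j) =
    (\<Prod>j\<in>UNIV. if i = j then b j else 1)"
    by (intro prod.cong) (auto simp: lookup_single when_def)
  then show ?thesis by (simp add: Var_def psub_single one)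
qed

text \<open>Composites of substitutions are again substitutions, so two of them agree as soon as
  they agree on constants and variables. Most identities between such maps below are obtained this
  way.\<close>

lemma morphism_psub:
  assumes "comm_ring_morphism g"
  shows "g (psub c b f) = psub (\<lambda>x. g (c x)) (\<lambda>i. g (b i)) f"
proof -
  interpret comm_ring_morphism g by fact
  show ?thesis by (simp add: psub_def sum mult prod power)
qed

lemma prod_Var_power:
  "(\<Prod>i\<in>UNIV. (Var i :: 'a::field poly3) ^ Poly_Mapping.lookup m i) = Poly_Mapping.single m 1"
proof -
  have pow: "(Var i :: 'a poly3) ^ k = Poly_Mapping.single (Poly_Mapping.single i k) 1" for i k
    by (induction k) (auto simp: Var_def mult_single simp flip: single_add)
  have "(\<Prod>i\<in>A. (Var i :: 'a poly3) ^ Poly_Mapping.lookup m i) =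
    Poly_Mapping.single (\<Sum>i\<in>A. Poly_Mapping.single i (Poly_Mapping.lookup m i)) 1" for A
    by (induction A rule: infinite_finite_induct) (auto simp: pow mult_single)
  moreover have "(\<Sum>i\<in>UNIV. Poly_Mapping.single i (Poly_Mapping.lookup m i)) = m"
    by (rule poly_mapping_eqI) (simp add: lookup_sum lookup_single when_def)
  ultimately show ?thesis by simp
qed

lemma psub_id: "psub (Poly_Mapping.single 0) Var f = f"
  using poly3_sum_singles[of f] by (simp add: psub_def prod_Var_power mult_single)

subsection \<open>Homogeneous components\<close>

text \<open>This is f(tx, ty, tz) as a polynomial in t, so its coefficients are the homogeneous
  components of f.\<close>

definition grading :: "'a::field poly3 \<Rightarrow> 'a poly3 poly"
  where "grading = psub (\<lambda>c. [:Poly_Mapping.single 0 c:]) (\<lambda>i. [:0, Var i:])"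

lemma const_single_morphism: "comm_ring_morphism (\<lambda>c::'a::field. [:Poly_Mapping.single 0 c :: 'a poly3:])"
  by (rule comm_ring_morphism_comp[OF comm_ring_morphism_const comm_ring_morphism_single])

interpretation grading: comm_ring_morphism grading
  unfolding grading_def by (rule psub_morphism[OF const_single_morphism])

lemma homogeneousD: "homogeneous d f \<Longrightarrow> m \<in> Poly_Mapping.keys f \<Longrightarrow> mon_degree m = d"
  by (simp add: homogeneous_def)

lemma psub_homogeneous:
  assumes "homogeneous d f"
  shows "psub c (\<lambda>i. y * b i) f = y ^ d * psub c b f"
proof -
  have "(\<Prod>i\<in>UNIV. (y * b i) ^ Poly_Mapping.lookup m i) = y ^ d * (\<Prod>i\<in>UNIV. b i ^ Poly_Mapping.lookup m i)"
    if "m \<in> Poly_Mapping.keys f" for m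
    using homogeneousD[OF assms that]
    by (auto simp: mon_degree_def power_mult_distrib prod.distrib power_sum)
  then show ?thesis by (simp add: psub_def sum_distrib_left algebra_simps)
qed

lemma grading_eq_sum:
  "grading f = (\<Sum>m\<in>Poly_Mapping.keys f. monom (Poly_Mapping.single m (Poly_Mapping.lookup f m)) (mon_degree m))"
proof -
  have "(\<Prod>i\<in>UNIV. [:0, Var i :: 'a poly3:] ^ Poly_Mapping.lookup m i) = monom (Poly_Mapping.single m 1) (mon_degree m)" for m
  proof -
    have pow: "[:0, c :: 'a poly3:] ^ k = monom (c ^ k) k" for c k
      by (induction k) (auto simp: monom_0 one_pCons monom_Suc smult_monom)
    have "(\<Prod>i\<in>UNIV. [:0, Var i :: 'a poly3:] ^ Poly_Mapping.lookup m i)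
      = (\<Prod>i\<in>UNIV. monom (Var i ^ Poly_Mapping.lookup m i) (Poly_Mapping.lookup m i))"
      by (simp only: pow)
    also have "(\<Prod>i\<in>A. monom (Var i ^ Poly_Mapping.lookup m i) (Poly_Mapping.lookup m i))
      = monom (\<Prod>i\<in>A. (Var i :: 'a poly3) ^ Poly_Mapping.lookup m i) (\<Sum>i\<in>A. Poly_Mapping.lookup m i)" for A
      by (induction A rule: infinite_finite_induct) (auto simp: mult_monom one_pCons monom_0)
    finally show ?thesis by (simp add: prod_Var_power mon_degree_def)
  qed
  then show ?thesis by (simp add: grading_def psub_def smult_monom mult_single)
qed

lemma homogeneous_0 [simp]: "homogeneous d 0"
  by (simp add: homogeneous_def)

lemma homogeneous_add: "homogeneous d f \<Longrightarrow> homogeneous d g \<Longrightarrow> homogeneous d (f + g)"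
  using keys_add[of f g] by (auto simp: homogeneous_def)

lemma homogeneous_sum: "(\<And>a. a \<in> A \<Longrightarrow> homogeneous d (f a)) \<Longrightarrow> homogeneous d (sum f A)"
  by (induction A rule: infinite_finite_induct) (auto intro: homogeneous_add)

lemma homogeneous_coeff_grading: "homogeneous d (coeff (grading f) d)"
proof -
  have "homogeneous d (if mon_degree m = d then Poly_Mapping.single m a else 0)" for m and a :: 'a
    by (auto simp: homogeneous_def split: if_splits)
  then show ?thesis
    by (auto simp: grading_eq_sum coeff_sum intro!: homogeneous_sum)
qed

lemma grading_homogeneous: "homogeneous d f \<Longrightarrow> grading f = monom f d"
proof -
  assume *: "homogeneous d f"
  have "grading f = (\<Sum>m\<in>Poly_Mapping.keys f. monom (Poly_Mapping.single m (Poly_Mapping.lookup f m)) d)"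
    unfolding grading_eq_sum by (intro sum.cong) (auto simp: homogeneousD[OF *])
  also have "\<dots> = monom (\<Sum>m\<in>Poly_Mapping.keys f. Poly_Mapping.single m (Poly_Mapping.lookup f m)) d"
    by (rule poly_eqI) (simp add: coeff_sum)
  finally show ?thesis using poly3_sum_singles[of f] by simp
qed

lemma homogeneous_iff_grading: "homogeneous d f \<longleftrightarrow> grading f = monom f d"
  using grading_homogeneous homogeneous_coeff_grading[of d f] by fastforce

lemma sum_coeff_grading: "(\<Sum>d\<le>degree (grading f). coeff (grading f) d) = f"
proof -
  have "poly (grading f) 1 = f"
    unfolding grading_def
    by (subst morphism_psub[OF comm_ring_morphism_poly]) (simp add: psub_id)
  then show ?thesis by (simp add: poly_altdef)
qed

lemma homogeneous_mult: "homogeneous d f \<Longrightarrow> homogeneous e g \<Longrightarrow> homogeneous (d + e) (f * g)"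
  by (simp add: homogeneous_iff_grading grading.mult mult_monom)

lemma homogeneous_diff: "homogeneous d f \<Longrightarrow> homogeneous d g \<Longrightarrow> homogeneous d (f - g)"
  by (simp add: homogeneous_iff_grading grading.diff diff_monom)

lemma homogeneous_single_0: "homogeneous 0 (Poly_Mapping.single 0 c)"
  by (auto simp: homogeneous_def mon_degree_def split: if_splits)

lemma homogeneous_1: "homogeneous 0 1"
  using homogeneous_single_0[of 1] by simp

lemma homogeneous_smult: "homogeneous d f \<Longrightarrow> homogeneous d (Poly_Mapping.single 0 c * f)"
  using homogeneous_mult[OF homogeneous_single_0] by fastforce

lemma homogeneous_power: "homogeneous d f \<Longrightarrow> homogeneous (k * d) (f ^ k)"
  by (induction k) (auto intro: homogeneous_1 homogeneous_mult)

lemma homogeneous_prod: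
  "(\<And>a. a \<in> A \<Longrightarrow> homogeneous (d a) (f a)) \<Longrightarrow> homogeneous (sum d A) (prod f A)"
  by (induction A rule: infinite_finite_induct) (auto intro: homogeneous_1 homogeneous_mult)

text \<open>The quotient is not known to be homogeneous. Comparing coefficients of t^e in the
  gradings shows that its component of degree e - d already gives \<open>p\<close>, and
  \<open>p\<close> being nonzero forces d <= e.\<close>

lemma homogeneous_dvd:
  fixes p l :: "'a::field poly3"
  assumes "homogeneous d l" "l \<noteq> 0" "homogeneous e p" "p \<noteq> 0" "l dvd p"
  obtains g where "p = l * g" "d \<le> e" "homogeneous (e - d) g"
proof -
  obtain g where g: "p = l * g" using assms by blast
  have *: "monom p e = monom l d * grading g"
    using g assms by (metis grading.mult grading_homogeneous)
  have c: "coeff (monom l d * grading g) e = (if d \<le> e then l * coeff (grading g) (e - d) else 0)"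
    by (simp add: coeff_monom_mult)
  have "coeff (monom p e) e = p" by simp
  then have "d \<le> e" and "p = l * coeff (grading g) (e - d)"
    using c assms(4) unfolding * by (auto split: if_splits)
  then show ?thesis using that homogeneous_coeff_grading by blast
qed

subsection \<open>Order of vanishing at a vector\<close>

text \<open>
  The order of vanishing at \<open>v\<close> is the \<open>t\<close>-adic order of \<open>f(v + t (x, y, z))\<close>. As \<open>K[x,y,z][t]\<close> is a
  domain, this is a valuation, so that a linear factor can be cancelled without losing orders.
\<close>

definition taylor :: "'a::field ^ 3 \<Rightarrow> 'a poly3 \<Rightarrow> 'a poly3 poly"
  where "taylor v = psub (\<lambda>c. [:Poly_Mapping.single 0 c:]) (\<lambda>i. [:Poly_Mapping.single 0 (v $ i), Var i:])"

definition vanishes_to_order :: "'a::field ^ 3 \<Rightarrow> nat \<Rightarrow> 'a poly3 \<Rightarrow> bool"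
  where "vanishes_to_order v m f \<longleftrightarrow> [:0, 1:] ^ m dvd taylor v f"

interpretation taylor: comm_ring_morphism "taylor v"
  unfolding taylor_def by (rule psub_morphism[OF const_single_morphism])

interpretation evaluation: comm_ring_morphism "\<lambda>f. poly_eval f v"
  unfolding poly_eval_eq_psub by (rule psub_morphism[OF comm_ring_morphism_id])

lemma mon_degree_1E:
  assumes "mon_degree m = 1"
  obtains i where "m = Poly_Mapping.single i 1"
proof -
  from assms have "(\<Sum>i\<in>UNIV. Poly_Mapping.lookup m i) = Suc 0" by (simp add: mon_degree_def)
  then obtain i where i: "Poly_Mapping.lookup m i = Suc 0" "\<And>j. j \<noteq> i \<Longrightarrow> Poly_Mapping.lookup m j = 0"
    unfolding sum_eq_Suc0_iff[OF finite] by auto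
  have "m = Poly_Mapping.single i 1"
    by (rule poly_mapping_eqI) (use i in \<open>auto simp: lookup_single when_def\<close>)
  then show ?thesis by (rule that)
qed

lemma single_eqD:
  "Poly_Mapping.single i (Suc 0) = Poly_Mapping.single j (Suc 0) \<Longrightarrow> i = j"
  by (metis lookup_single_eq lookup_single_not_eq nat.distinct(1))

lemma linear_form_eq:
  assumes "homogeneous 1 (l :: 'a::field poly3)"
  obtains c :: "3 \<Rightarrow> 'a::field" where "l = (\<Sum>i\<in>UNIV. Poly_Mapping.single 0 (c i) * Var i)"
proof
  let ?s = "\<lambda>i::3. Poly_Mapping.single i (1::nat)"
  have "l = (\<Sum>m\<in>?s ` UNIV. Poly_Mapping.single m (Poly_Mapping.lookup l m))"
    by (subst poly3_sum_singles, rule sum.mono_neutral_left)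
       (auto simp: in_keys_iff intro: mon_degree_1E[OF homogeneousD[OF assms]] )
  also have "\<dots> = (\<Sum>i\<in>UNIV. Poly_Mapping.single (?s i) (Poly_Mapping.lookup l (?s i)))"
    by (subst sum.reindex) (auto simp: inj_on_def dest: single_eqD)
  finally show "l = (\<Sum>i\<in>UNIV. Poly_Mapping.single 0 (Poly_Mapping.lookup l (?s i)) * Var i)"
    by (simp add: Var_def mult_single)
qed

lemma psub_linear_form:
  assumes "homogeneous 1 (l :: 'a::field poly3)" "comm_ring_morphism c"
  shows "psub c (\<lambda>i. y * p i + z * q i) l = y * psub c p l + z * psub c q l"
proof -
  obtain a where l: "l = (\<Sum>i\<in>UNIV. Poly_Mapping.single 0 (a i) * Var i)"
    using linear_form_eq[OF assms(1)] .
  have "psub c b l = (\<Sum>i\<in>UNIV. c (a i) * b i)" for b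
    unfolding l comm_ring_morphism.sum[OF psub_morphism[OF assms(2)]]
    by (simp add: comm_ring_morphism.mult[OF psub_morphism[OF assms(2)]] psub_Var[OF assms(2)]
        comm_ring_morphism.psub_single[OF assms(2)])
  then show ?thesis by (simp add: algebra_simps sum.distrib sum_distrib_left)
qed

lemma single_0_poly_eval: "psub (Poly_Mapping.single 0) (\<lambda>i. Poly_Mapping.single 0 (v $ i)) f = (Poly_Mapping.single 0 (poly_eval f v) :: 'a::field poly3)"
  by (simp add: poly_eval_eq_psub morphism_psub[OF comm_ring_morphism_single])

lemma taylor_linear_form:
  fixes l :: "'a::field poly3"
  assumes "homogeneous 1 l"
  shows "taylor v l = [:Poly_Mapping.single 0 (poly_eval l v), l:]"
proof -
  have "taylor v l = psub (\<lambda>c. [:Poly_Mapping.single 0 c:])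
    (\<lambda>i. 1 * [:Poly_Mapping.single 0 (v $ i):] + [:0, 1:] * [:Var i:]) l"
    by (simp add: taylor_def one_pCons)
  also have "\<dots> = 1 * psub (\<lambda>c. [:Poly_Mapping.single 0 c:]) (\<lambda>i. [:Poly_Mapping.single 0 (v $ i):]) l
    + [:0, 1:] * psub (\<lambda>c. [:Poly_Mapping.single 0 c:]) (\<lambda>i. [:Var i:]) l"
    by (rule psub_linear_form[OF assms const_single_morphism])
  also have "psub (\<lambda>c. [:Poly_Mapping.single 0 c:]) (\<lambda>i. [:Poly_Mapping.single 0 (v $ i):]) l
    = [:Poly_Mapping.single 0 (poly_eval l v) :: 'a poly3:]"
    by (simp add: morphism_psub[OF comm_ring_morphism_const, symmetric] single_0_poly_eval)
  also have "psub (\<lambda>c. [:Poly_Mapping.single 0 c:]) (\<lambda>i. [:Var i:]) l = [:l:]"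
    by (simp add: morphism_psub[OF comm_ring_morphism_const, symmetric] psub_id)
  finally show ?thesis by simp
qed

lemma vanishes_to_order_0 [simp]: "vanishes_to_order v 0 f"
  by (simp add: vanishes_to_order_def)

lemma vanishes_to_order_mono: "vanishes_to_order v m f \<Longrightarrow> k \<le> m \<Longrightarrow> vanishes_to_order v k f"
  unfolding vanishes_to_order_def using le_imp_power_dvd dvd_trans by blast

lemma vanishes_to_order_mult:
  "vanishes_to_order v m f \<Longrightarrow> vanishes_to_order v k g \<Longrightarrow> vanishes_to_order v (m + k) (f * g)"
  by (simp add: vanishes_to_order_def taylor.mult power_add mult_dvd_mono)

lemma vanishes_to_order_mult_right: "vanishes_to_order v m g \<Longrightarrow> vanishes_to_order v m (f * g)"
  by (simp add: vanishes_to_order_def taylor.mult)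

lemma vanishes_to_order_add:
  "vanishes_to_order v m f \<Longrightarrow> vanishes_to_order v m g \<Longrightarrow> vanishes_to_order v m (f + g)"
  by (simp add: vanishes_to_order_def taylor.add)

lemma vanishes_to_order_diff:
  "vanishes_to_order v m f \<Longrightarrow> vanishes_to_order v m g \<Longrightarrow> vanishes_to_order v m (f - g)"
  by (simp add: vanishes_to_order_def taylor.diff)

lemma vanishes_to_order_power:
  "vanishes_to_order v m f \<Longrightarrow> vanishes_to_order v (k * m) (f ^ k)"
  by (induction k) (auto intro: vanishes_to_order_mult)

lemma vanishes_to_order_linear_form:
  "homogeneous 1 l \<Longrightarrow> poly_eval l v = 0 \<Longrightarrow> vanishes_to_order v 1 l"
  by (simp add: vanishes_to_order_def taylor_linear_form dvd_def exI[of _ "[:l:]"])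

lemma vanishes_to_order_prod:
  assumes "finite A" "\<And>a. a \<in> A \<Longrightarrow> homogeneous 1 (l a)"
  shows "vanishes_to_order v (card {a \<in> A. poly_eval (l a) v = 0}) (prod l A)"
  using assms
proof (induction A)
  case (insert a A)
  let ?T = "{b \<in> A. poly_eval (l b) v = 0}"
  have IH: "vanishes_to_order v (card ?T) (prod l A)" using insert by blast
  show ?case
  proof (cases "poly_eval (l a) v = 0")
    case True
    then have "{b \<in> insert a A. poly_eval (l b) v = 0} = insert a ?T" by auto
    moreover have "vanishes_to_order v (1 + card ?T) (l a * prod l A)"
      using insert True by (intro vanishes_to_order_mult[OF vanishes_to_order_linear_form IH]) auto
    ultimately show ?thesis using insert by simp
  next
    case False
    then have "{b \<in> insert a A. poly_eval (l b) v = 0} = ?T" by auto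
    then show ?thesis using insert vanishes_to_order_mult_right[OF IH] by simp
  qed
qed simp

lemma linear_power_dvd_multD:
  fixes p q :: "'a::idom poly"
  assumes "[:- a, 1:] ^ m dvd p * q" "poly p a \<noteq> 0"
  shows "[:- a, 1:] ^ m dvd q"
proof (cases "q = 0")
  case False
  have "p \<noteq> 0" using assms(2) by auto
  moreover have "order a p = 0" using assms(2) by (simp add: order_0I)
  ultimately show ?thesis
    using assms(1) False by (auto simp: order_divides order_mult)
qed simp

text \<open>The expansion of \<open>l\<close> at \<open>v\<close> is l(v) + t l. It is prime to t if
  l(v) is nonzero; otherwise it is t times the nonzero constant \<open>l\<close>, and one factor t
  cancels.\<close>

lemma vanishes_to_order_divide_linear_form:
  assumes "homogeneous 1 l" "l \<noteq> 0" "vanishes_to_order v m (l * g)"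
  shows "vanishes_to_order v (m - (if poly_eval l v = 0 then 1 else 0)) g"
proof -
  have *: "[:0, 1:] ^ m dvd [:Poly_Mapping.single 0 (poly_eval l v), l:] * taylor v g"
    using assms(3) by (simp add: vanishes_to_order_def taylor.mult taylor_linear_form[OF assms(1)] del: mult_pCons_left)
  show ?thesis
  proof (cases "poly_eval l v = 0")
    case False
    then have "Poly_Mapping.single 0 (poly_eval l v) \<noteq> (0 :: 'a poly3)"
      by (metis lookup_single_eq lookup_zero)
    moreover have "[:- 0, 1:] ^ m dvd [:Poly_Mapping.single 0 (poly_eval l v), l:] * taylor v g"
      using * by (simp only: minus_zero)
    ultimately show ?thesis
      using linear_power_dvd_multD False by (fastforce simp: vanishes_to_order_def simp del: mult_pCons_left)
  next
    case True
    show ?thesis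
    proof (cases m)
      case (Suc k)
      have "[:0, 1:] * [:0, 1:] ^ k dvd [:0, 1:] * ([:l:] * taylor v g)"
        using * True Suc by simp
      then have "[:- 0, 1:] ^ k dvd [:l:] * taylor v g" by (subst (asm) dvd_mult_cancel_left) auto
      then show ?thesis
        using linear_power_dvd_multD[of 0 k "[:l:]" "taylor v g"] assms(2) True Suc
        by (simp add: vanishes_to_order_def)
    qed simp
  qed
qed

subsection \<open>Restriction to a line\<close>

definition line_restrict :: "'a::field ^ 3 \<Rightarrow> 'a ^ 3 \<Rightarrow> 'a poly3 \<Rightarrow> 'a poly"
  where "line_restrict u w = psub (\<lambda>c. [:c:]) (\<lambda>i. [:u $ i, w $ i:])"

interpretation line_restrict: comm_ring_morphism "line_restrict u w"
  unfolding line_restrict_def by (rule psub_morphism[OF comm_ring_morphism_const])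

lemma line_restrict_single_0 [simp]: "line_restrict u w (Poly_Mapping.single 0 c) = [:c:]"
  by (simp add: line_restrict_def comm_ring_morphism.psub_single[OF comm_ring_morphism_const])

lemma poly_restrict: "poly (line_restrict u w f) a = poly_eval f (u + a *s w)"
  by (simp add: line_restrict_def morphism_psub[OF comm_ring_morphism_poly] poly_eval_eq_psub mult.commute)

lemma line_restrict_linear_form:
  assumes "homogeneous 1 l"
  shows "line_restrict u w l = [:poly_eval l u, poly_eval l w:]"
proof -
  have "line_restrict u w l = psub (\<lambda>c. [:c:]) (\<lambda>i. 1 * [:u $ i:] + [:0, 1:] * [:w $ i:]) l"
    by (simp add: line_restrict_def one_pCons)
  also have "\<dots> = 1 * psub (\<lambda>c. [:c:]) (\<lambda>i. [:u $ i:]) l + [:0, 1:] * psub (\<lambda>c. [:c:]) (\<lambda>i. [:w $ i:]) l"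
    by (rule psub_linear_form[OF assms comm_ring_morphism_const])
  finally show ?thesis
    by (simp add: morphism_psub[OF comm_ring_morphism_const, symmetric] poly_eval_eq_psub)
qed

lemma degree_restrict_le:
  assumes "homogeneous d f"
  shows "degree (line_restrict u w f) \<le> d"
proof -
  have "degree ([:c:] * (\<Prod>i\<in>UNIV. [:u $ i, w $ i:] ^ Poly_Mapping.lookup m i)) \<le> d"
    if "m \<in> Poly_Mapping.keys f" for m c
  proof -
    have "degree (\<Prod>i\<in>UNIV. [:u $ i, w $ i:] ^ Poly_Mapping.lookup m i) \<le>
      (\<Sum>i\<in>UNIV. degree ([:u $ i, w $ i:] ^ Poly_Mapping.lookup m i))"
      by (rule order_trans[OF degree_prod_sum_le]) (auto simp: o_def)
    also have "\<dots> \<le> (\<Sum>i\<in>UNIV. Poly_Mapping.lookup m i)"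
      by (rule sum_mono, rule order_trans[OF degree_power_le]) auto
    also have "\<dots> = d" using homogeneousD[OF assms that] by (simp add: mon_degree_def)
    finally show ?thesis by (simp add: degree_smult_le order_trans)
  qed
  then show ?thesis unfolding line_restrict_def psub_def by (intro degree_sum_le) auto
qed

text \<open>Restriction factors through the Taylor expansion at u + a w: replace the variables by
  the coordinates of \<open>w\<close> and t by t - a, since (u + a w) + (t - a) w = u + t w.\<close>

lemma vanishes_to_order_restrict:
  assumes "vanishes_to_order (u + a *s w) m f"
  shows "[:- a, 1:] ^ m dvd line_restrict u w f"
proof -
  let ?\<kappa> = "\<lambda>f. [:poly_eval f w:]"
  have \<kappa>: "comm_ring_morphism ?\<kappa>"
    by (rule comm_ring_morphism_comp[OF comm_ring_morphism_const evaluation.comm_ring_morphism_axioms])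
  interpret g: comm_ring_morphism "\<lambda>p. poly (map_poly ?\<kappa> p) [:- a, 1:]"
    by (rule comm_ring_morphism_comp[OF comm_ring_morphism_poly comm_ring_morphism.map_poly[OF \<kappa>]])
  have \<kappa>0: "?\<kappa> 0 = 0" by (simp add: evaluation.zero)
  have eval_Var: "poly_eval (Var i) w = w $ i" for i
    by (simp add: poly_eval_eq_psub psub_Var[OF comm_ring_morphism_id])
  have eval_single: "poly_eval (Poly_Mapping.single 0 c) w = c" for c
    by (simp add: poly_eval_eq_psub comm_ring_morphism.psub_single[OF comm_ring_morphism_id])
  have "poly (map_poly ?\<kappa> (taylor (u + a *s w) f)) [:- a, 1:] = line_restrict u w f"
    unfolding taylor_def line_restrict_def
    by (subst morphism_psub[OF g.comm_ring_morphism_axioms])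
       (simp add: map_poly_pCons \<kappa>0 evaluation.zero eval_Var eval_single algebra_simps)
  moreover have "poly (map_poly ?\<kappa> [:0, 1:]) [:- a, 1:] = [:- a, 1:]"
    by (simp add: map_poly_pCons evaluation.zero evaluation.one)
  ultimately show ?thesis
    using g.dvd[OF assms[unfolded vanishes_to_order_def]] by (simp add: g.power)
qed

text \<open>
  The line \<open>l = 0\<close> is parametrised by \<open>a \<mapsto> u + a w\<close>, with \<open>w\<close> as the point at infinity, and \<open>\<alpha>\<close>, \<open>\<beta>\<close>
  restrict to its homogeneous coordinates.
\<close>

locale line_frame =
  fixes l :: "'a::field poly3" and u w :: "'a ^ 3" and \<alpha> \<beta> :: "'a poly3" and e :: "'a ^ 3"
  assumes linear: "homogeneous 1 l" "homogeneous 1 \<alpha>" "homogeneous 1 \<beta>"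
    and nonzero: "l \<noteq> 0"
    and eval_l: "poly_eval l u = 0" "poly_eval l w = 0"
    and eval_\<alpha>: "poly_eval \<alpha> u = 1" "poly_eval \<alpha> w = 0"
    and eval_\<beta>: "poly_eval \<beta> u = 0" "poly_eval \<beta> w = 1"
    and Var_eq: "Var i = Poly_Mapping.single 0 (u $ i) * \<alpha> + Poly_Mapping.single 0 (w $ i) * \<beta> + Poly_Mapping.single 0 (e $ i) * l"
begin

lemma line_restrict_frame: "line_restrict u w l = 0" "line_restrict u w \<alpha> = 1" "line_restrict u w \<beta> = [:0, 1:]"
  by (simp_all add: linear[THEN line_restrict_linear_form] eval_l eval_\<alpha> eval_\<beta> one_pCons)

lemma point_nonzero: "u + a *s w \<noteq> 0"
proof
  assume "u + a *s w = 0"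
  then have "poly (line_restrict u w \<alpha>) a = poly_eval \<alpha> 0" by (simp only: poly_restrict)
  also have "\<dots> = poly (line_restrict 0 0 \<alpha>) 0" by (simp add: poly_restrict)
  also have "line_restrict 0 0 \<alpha> = [:0:]"
    using psub_homogeneous[OF linear(2), of "\<lambda>c. [:c:]" 0 "\<lambda>i. 0"] by (simp add: line_restrict_def)
  finally show False by (simp add: line_restrict_frame)
qed

text \<open>Substitutes l = 0 in the coordinates (\<alpha>, \<beta>, l), a homomorphism onto
  K[\<alpha>, \<beta>] whose kernel is generated by \<open>l\<close>.\<close>

definition project :: "'a poly3 \<Rightarrow> 'a poly3"
  where "project = psub (Poly_Mapping.single 0)
    (\<lambda>i. Poly_Mapping.single 0 (u $ i) * \<alpha> + Poly_Mapping.single 0 (w $ i) * \<beta>)"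

sublocale project: comm_ring_morphism project
  unfolding project_def by (rule psub_morphism[OF comm_ring_morphism_single])

lemma project_l: "project l = 0"
  using psub_linear_form[OF linear(1) comm_ring_morphism_single, of \<alpha> "\<lambda>i. Poly_Mapping.single 0 (u $ i)"
      \<beta> "\<lambda>i. Poly_Mapping.single 0 (w $ i)"]
  by (simp add: project_def single_0_poly_eval eval_l mult.commute)

text \<open>Writing t for \<open>l\<close> in the coordinates (\<alpha>, \<beta>, l) gives a
  polynomial \<open>q\<close> in t with value f at t = l and \<open>project f\<close> at t = 0; two
  such values differ by a multiple of l - 0.\<close>

lemma dvd_diff_project: "l dvd f - project f"
proof -
  define q where "q = psub (\<lambda>c. [:Poly_Mapping.single 0 c:]) (\<lambda>i. [:Poly_Mapping.single 0 (u $ i) * \<alpha> + Poly_Mapping.single 0 (w $ i) * \<beta>,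
    Poly_Mapping.single 0 (e $ i):]) f"
  have "poly q 0 = project f"
    by (simp add: q_def project_def morphism_psub[OF comm_ring_morphism_poly])
  moreover have "poly q l = f"
    using psub_id[of f]
    by (simp add: q_def morphism_psub[OF comm_ring_morphism_poly] Var_eq[symmetric] mult.commute[of l])
  moreover have "l dvd poly q l - poly q 0"
    by (cases q) auto
  ultimately show ?thesis by simp
qed

lemma dvd_iff_project: "l dvd f \<longleftrightarrow> project f = 0"
proof
  assume "project f = 0"
  then show "l dvd f" using dvd_diff_project[of f] by simp
qed (auto simp: dvd_def project.mult project_l)

text \<open>\<open>l\<close> generates the kernel of \<open>project\<close>, a homomorphism into a
  domain.\<close>

lemma prime: "prime_elem l"
  unfolding prime_elem_def using nonzero
  by (auto simp: dvd_iff_project project.mult project.one)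

text \<open>
  Homogenisation without denominators: for \<open>p(t) = f(\<alpha> u + t w)\<close> one has
  \<open>p(\<alpha> t) = \<alpha>\<^sup>d f(u + t w)\<close>, while \<open>p(\<beta>)\<close> is \<open>f\<close> modulo \<open>l\<close>.
\<close>

lemma dvd_of_restrict_eq_0:
  assumes "homogeneous d f" "line_restrict u w f = 0"
  shows "l dvd f"
proof -
  let ?s = "Poly_Mapping.single 0 :: 'a \<Rightarrow> 'a poly3"
  define p where "p = psub (\<lambda>c. [:?s c:]) (\<lambda>i. [:?s (u $ i) * \<alpha>, ?s (w $ i):]) f"
  have "pcompose p [:0, \<alpha>:] = psub (\<lambda>c. [:?s c:]) (\<lambda>i. [:\<alpha>:] * [:?s (u $ i), ?s (w $ i):]) f"
    by (simp add: p_def morphism_psub[OF comm_ring_morphism_pcompose] pcompose_pCons mult.commute)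
  also have "\<dots> = [:\<alpha>:] ^ d * psub (\<lambda>c. [:?s c:]) (\<lambda>i. [:?s (u $ i), ?s (w $ i):]) f"
    by (rule psub_homogeneous[OF assms(1)])
  also have "psub (\<lambda>c. [:?s c:]) (\<lambda>i. [:?s (u $ i), ?s (w $ i):]) f = map_poly ?s (line_restrict u w f)"
    by (simp add: line_restrict_def morphism_psub[OF comm_ring_morphism.map_poly[OF comm_ring_morphism_single]] map_poly_pCons)
  finally have "pcompose p [:0, \<alpha>:] = 0" by (simp add: assms)
  moreover have "\<alpha> \<noteq> 0" using eval_\<alpha> by (auto simp: evaluation.zero)
  ultimately have "p = 0" using pcompose_eq_0[of p "[:0, \<alpha>:]"] by simp
  moreover have "poly p \<beta> = project f"
    by (simp add: p_def project_def morphism_psub[OF comm_ring_morphism_poly] mult.commute)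
  ultimately show ?thesis by (simp add: dvd_iff_project)
qed

end


subsection \<open>Ideal powers\<close>

abbreviation typeR :: "'b::comm_ring_1 ring"
  where "typeR \<equiv> ring_of_type_algebra"

lemma ideal_type_iff:
  fixes J :: "'b::comm_ring_1 set"
  shows "ideal J typeR \<longleftrightarrow>
    0 \<in> J \<and> (\<forall>x\<in>J. \<forall>y\<in>J. x + y \<in> J) \<and> (\<forall>a. \<forall>x\<in>J. a * x \<in> J)"
proof
  let ?R = "typeR :: 'b ring"
  assume "ideal J ?R"
  then interpret ideal J ?R .
  have "0 \<in> J"
    using additive_subgroup.zero_closed[OF ideal.axioms(1)[OF \<open>ideal J ?R\<close>]] by (simp add: ring_of_type_algebra_def)
  moreover have "x + y \<in> J" if "x \<in> J" "y \<in> J" for x y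
    using additive_subgroup.a_closed[OF ideal.axioms(1)[OF \<open>ideal J ?R\<close>] that] by (simp add: ring_of_type_algebra_def)
  moreover have "a * x \<in> J" if "x \<in> J" for a x
    using I_l_closed[OF that, of a] by (simp add: ring_of_type_algebra_def)
  ultimately show "0 \<in> J \<and> (\<forall>x\<in>J. \<forall>y\<in>J. x + y \<in> J) \<and> (\<forall>a. \<forall>x\<in>J. a * x \<in> J)"
    by blast
next
  let ?R = "typeR :: 'b ring"
  assume J: "0 \<in> J \<and> (\<forall>x\<in>J. \<forall>y\<in>J. x + y \<in> J) \<and> (\<forall>a. \<forall>x\<in>J. a * x \<in> J)"
  interpret cring ?R by (rule cring_from_type_algebra)
  have inv: "\<ominus>\<^bsub>?R\<^esub> x = - x" for x
    by (rule minus_equality) (auto simp: ring_of_type_algebra_def)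
  have "- x \<in> J" "x * a \<in> J" if "x \<in> J" for x a
    using J that by (metis mult_minus1, metis mult.commute)
  then show "ideal J ?R"
    using J inv by (intro idealI ring_axioms add.subgroupI) (auto simp: ring_of_type_algebra_def)
qed

context
  fixes J :: "'b::comm_ring_1 set"
  assumes J: "ideal J typeR"
begin

lemma ideal_type_zero: "0 \<in> J"
  and ideal_type_add: "x \<in> J \<Longrightarrow> y \<in> J \<Longrightarrow> x + y \<in> J"
  and ideal_type_mult: "x \<in> J \<Longrightarrow> a * x \<in> J"
  using J unfolding ideal_type_iff by blast+

lemma ideal_type_sum: "(\<And>a. a \<in> A \<Longrightarrow> f a \<in> J) \<Longrightarrow> sum f A \<in> J"
  by (induction A rule: infinite_finite_induct) (auto intro: ideal_type_zero ideal_type_add)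

end

lemma ideal_type_genideal: "ideal (Idl\<^bsub>typeR\<^esub> E) (typeR :: 'b::comm_ring_1 ring)"
  by (rule ring.genideal_ideal[OF ring_from_type_algebra]) (simp add: ring_of_type_algebra_def)

lemma genideal_type_mem: "x \<in> E \<Longrightarrow> (x :: 'b::comm_ring_1) \<in> Idl\<^bsub>typeR\<^esub> E"
  using ring.genideal_self[OF ring_from_type_algebra, of E] by (auto simp: ring_of_type_algebra_def)

lemma genideal_type_subset:
  "ideal J typeR \<Longrightarrow> E \<subseteq> J \<Longrightarrow> Idl\<^bsub>typeR\<^esub> E \<subseteq> (J :: 'b::comm_ring_1 set)"
  by (rule ring.genideal_minimal[OF ring_from_type_algebra])

lemma ideal_prod_type_ideal:
  "ideal J typeR \<Longrightarrow> ideal J' typeR \<Longrightarrow>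
    ideal (J \<cdot>\<^bsub>typeR\<^esub> J') (typeR :: 'b::comm_ring_1 ring)"
  by (rule ring.ideal_prod_is_ideal[OF ring_from_type_algebra])

lemma ideal_prod_type_mem:
  "x \<in> J \<Longrightarrow> y \<in> J' \<Longrightarrow> (x * y :: 'b::comm_ring_1) \<in> J \<cdot>\<^bsub>typeR\<^esub> J'"
  using ideal_prod.prod[of x J y J' "typeR :: 'b ring"] by (simp add: ring_of_type_algebra_def)

lemma ideal_prod_type_induct [consumes 1, case_names mult add]:
  assumes "z \<in> J \<cdot>\<^bsub>typeR\<^esub> J'"
    and "\<And>x y. x \<in> J \<Longrightarrow> y \<in> J' \<Longrightarrow> P (x * y)"
    and "\<And>x y. P x \<Longrightarrow> P y \<Longrightarrow> P (x + y :: 'b::comm_ring_1)"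
  shows "P z"
  using assms(1) by induction (use assms(2,3) in \<open>auto simp: ring_of_type_algebra_def\<close>)

definition idpow :: "'b::comm_ring_1 set \<Rightarrow> nat \<Rightarrow> 'b set"
  where "idpow J k = J [^]\<^bsub>ideals_set typeR\<^esub> k"

lemma idpow_0: "idpow J 0 = UNIV"
  by (simp add: idpow_def nat_pow_def ideals_set_def ring_of_type_algebra_def)

lemma idpow_Suc: "idpow J (Suc k) = idpow J k \<cdot>\<^bsub>typeR\<^esub> J"
  by (simp add: idpow_def nat_pow_def ideals_set_def)

lemma idpow_ideal:
  assumes "ideal J typeR"
  shows "ideal (idpow J k) (typeR :: 'b::comm_ring_1 ring)"
proof (induction k)
  case 0
  show ?case unfolding idpow_0 ideal_type_iff by simp
next
  case (Suc k)
  then show ?case unfolding idpow_Suc by (rule ideal_prod_type_ideal[OF _ assms])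
qed

lemma idpow_Suc_mem: "x \<in> idpow J k \<Longrightarrow> y \<in> J \<Longrightarrow> x * y \<in> idpow J (Suc k)"
  unfolding idpow_Suc by (rule ideal_prod_type_mem)

lemma idpow_mult:
  assumes J: "ideal J typeR" and x: "x \<in> idpow J i"
  shows "y \<in> idpow J k \<Longrightarrow> x * y \<in> idpow J (i + k)"
proof (induction k arbitrary: y)
  case 0
  then show ?case using ideal_type_mult[OF idpow_ideal[OF J] x, of y] by (simp add: mult.commute)
next
  case (Suc k)
  from Suc.prems[unfolded idpow_Suc] show ?case
  proof (induction rule: ideal_prod_type_induct)
    case (mult y z)
    then show ?case using idpow_Suc_mem[OF Suc.IH[OF mult(1)] mult(2)] by (simp add: mult.assoc)
  next
    case (add y z)
    then show ?case by (simp add: distrib_left ideal_type_add[OF idpow_ideal[OF J]] del: add_Suc_right)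
  qed
qed

lemma idpow_power:
  assumes "x \<in> J"
  shows "x ^ k \<in> idpow J k"
  by (induction k) (simp_all add: idpow_0 idpow_Suc_mem[OF _ assms] power_Suc2 del: power_Suc)

lemma idpow_antimono:
  assumes "ideal J typeR" "i \<le> k"
  shows "idpow J k \<subseteq> (idpow J i :: 'b::comm_ring_1 set)"
  using assms(2)
proof (induction rule: dec_induct)
  case (step k)
  have "idpow J (Suc k) \<subseteq> idpow J k"
    unfolding idpow_Suc
    using ring.ideal_prod_inter[OF ring_from_type_algebra idpow_ideal[OF assms(1)] assms(1)] by blast
  then show ?case using step.IH by blast
qed simp

text \<open>Turns membership in a power of an ideal into an order of vanishing: \<open>g\<close>
  will be built from a Taylor expansion and \<open>a\<close> from a power of t.\<close>

lemma idpow_dvd: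
  assumes g: "comm_ring_morphism g" and J: "\<And>x. x \<in> J \<Longrightarrow> a dvd g x"
  shows "x \<in> idpow J k \<Longrightarrow> a ^ k dvd g x"
proof (induction k arbitrary: x)
  case (Suc k)
  interpret comm_ring_morphism g by fact
  from Suc.prems[unfolded idpow_Suc] show ?case
  proof (induction rule: ideal_prod_type_induct)
    case (mult x y)
    then show ?case using mult_dvd_mono[OF Suc.IH[OF mult(1)] J[OF mult(2)]]
      by (simp add: comm_ring_morphism.mult[OF g] mult.commute)
  qed (auto simp: comm_ring_morphism.add[OF g])
qed simp

lemma genideal_dvd:
  assumes g: "comm_ring_morphism g" and E: "\<And>x. x \<in> E \<Longrightarrow> a dvd g x"
    and x: "x \<in> Idl\<^bsub>typeR\<^esub> E"
  shows "a dvd g x"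
proof -
  interpret comm_ring_morphism g by fact
  have "ideal {x. a dvd g x} typeR"
    unfolding ideal_type_iff by (simp add: zero add mult)
  from genideal_type_subset[OF this, of E] show ?thesis using E x by auto
qed

lemma idpow_scale:
  assumes "\<And>x. x \<in> J \<Longrightarrow> a * x \<in> J'" and J': "ideal J' typeR"
  shows "x \<in> idpow J k \<Longrightarrow> a ^ k * x \<in> idpow J' k"
proof (induction k arbitrary: x)
  case 0
  then show ?case by (simp add: idpow_0)
next
  case (Suc k)
  from Suc.prems[unfolded idpow_Suc] show ?case
  proof (induction rule: ideal_prod_type_induct)
    case (mult x y)
    then show ?case using idpow_Suc_mem[OF Suc.IH[OF mult(1)] assms(1)[OF mult(2)]]
      by (simp add: mult_ac)
  next
    case (add x y)
    then show ?case by (simp add: distrib_left ideal_type_add[OF idpow_ideal[OF J']] del: power_Suc)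
  qed
qed

lemma homogeneous_in_irrelevant_power:
  assumes "homogeneous d f" "k \<le> d"
  shows "f \<in> idpow irrelevant_ideal k"
proof -
  let ?M = "irrelevant_ideal :: 'a poly3 set"
  have M: "ideal ?M typeR" unfolding irrelevant_ideal_def by (rule ideal_type_genideal)
  have Var: "Var i \<in> ?M" for i unfolding irrelevant_ideal_def by (rule genideal_type_mem) simp
  have prod: "(\<Prod>i\<in>A. Var i ^ Poly_Mapping.lookup m i) \<in> idpow ?M (\<Sum>i\<in>A. Poly_Mapping.lookup m i)"
    for A and m :: "3 \<Rightarrow>\<^sub>0 nat"
    by (induction A rule: infinite_finite_induct) (simp_all add: idpow_0 idpow_mult[OF M] idpow_power[OF Var])
  have "(\<Sum>m\<in>Poly_Mapping.keys f. Poly_Mapping.single 0 (Poly_Mapping.lookup f m) *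
      (\<Prod>i\<in>UNIV. Var i ^ Poly_Mapping.lookup m i)) \<in> idpow ?M d"
  proof (intro ideal_type_sum[OF idpow_ideal[OF M]] ideal_type_mult[OF idpow_ideal[OF M]])
    fix m assume "m \<in> Poly_Mapping.keys f"
    then have "(\<Sum>i\<in>UNIV. Poly_Mapping.lookup m i) = d"
      using homogeneousD[OF assms(1)] by (simp add: mon_degree_def)
    then show "(\<Prod>i\<in>UNIV. Var i ^ Poly_Mapping.lookup m i) \<in> idpow ?M d" using prod[where A = UNIV and m = m] by simp
  qed
  then have "f \<in> idpow ?M d" using psub_id[of f] by (simp add: psub_def)
  then show ?thesis using idpow_antimono[OF M assms(2)] by blast
qed

subsection \<open>Univariate polynomials\<close>

lemma prod_linear_power_dvd:
  fixes q :: "'b::idom poly"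
  assumes "finite B" "\<And>a. a \<in> B \<Longrightarrow> [:- a, 1:] ^ k a dvd q"
  shows "(\<Prod>a\<in>B. [:- a, 1:] ^ k a) dvd q"
  using assms
proof (induction B)
  case (insert a B)
  then obtain q' where q': "q = (\<Prod>a\<in>B. [:- a, 1:] ^ k a) * q'" by (auto simp: dvd_def)
  have "poly (\<Prod>a\<in>B. [:- a, 1:] ^ k a) a \<noteq> 0"
    using insert by (auto simp: poly_prod)
  moreover have "[:- a, 1:] ^ k a dvd (\<Prod>a\<in>B. [:- a, 1:] ^ k a) * q'"
    using insert.prems[of a] q' by blast
  ultimately have "[:- a, 1:] ^ k a dvd q'"
    by (rule linear_power_dvd_multD[rotated])
  then show ?case unfolding q' using insert.hyps by (simp add: mult.commute mult_dvd_mono)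
qed simp

lemma degree_prod_linear: "degree (\<Prod>a\<in>A. [:- f a, 1::'b::idom:]) = card A"
  by (subst degree_prod_eq_sum_degree) auto

lemma lagrange_interpolation:
  fixes p :: "'b::field poly"
  assumes "finite B" "degree p < card B"
  shows "p = (\<Sum>a\<in>B. smult (poly p a / (\<Prod>b\<in>B - {a}. a - b)) (\<Prod>b\<in>B - {a}. [:- b, 1:]))"
proof (rule poly_eqI_degree[where A = B])
  fix x assume x: "x \<in> B"
  have "poly (smult (poly p a / (\<Prod>b\<in>B - {a}. a - b)) (\<Prod>b\<in>B - {a}. [:- b, 1:])) x = (if a = x then poly p x else 0)"
    if "a \<in> B" for a
    using that x assms(1) by (auto simp: poly_prod)
  then show "poly p x = poly (\<Sum>a\<in>B. smult (poly p a / (\<Prod>b\<in>B - {a}. a - b)) (\<Prod>b\<in>B - {a}. [:- b, 1:])) x"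
    using x assms(1) by (simp add: poly_sum)
next
  have "card (B - {a}) < card B" if "a \<in> B" for a
    using that assms(1) by (rule card_Diff1_less[rotated])
  then have "degree (\<Sum>a\<in>B. smult (poly p a / (\<Prod>b\<in>B - {a}. a - b)) (\<Prod>b\<in>B - {a}. [:- b, 1:])) \<le> card B - 1"
    by (intro degree_sum_le[OF assms(1)] order_trans[OF degree_smult_le])
       (simp add: degree_prod_linear card_Diff_singleton)
  then show "degree (\<Sum>a\<in>B. smult (poly p a / (\<Prod>b\<in>B - {a}. a - b)) (\<Prod>b\<in>B - {a}. [:- b, 1:])) < card B"
    using assms(2) by linarith
qed (use assms in auto)

subsection \<open>Choosing coordinates on a line\<close>

lemma linear_form_eval:
  assumes "homogeneous 1 l"
  shows "poly_eval l (u + a *s w) = poly_eval l u + a * poly_eval l w"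
  using poly_restrict[of u w l a] by (simp add: line_restrict_linear_form[OF assms])

lemma poly_eval_Var [simp]: "poly_eval (Var i) v = v $ i"
  by (simp add: poly_eval_eq_psub psub_Var[OF comm_ring_morphism_id])

lemma poly_eval_single_0 [simp]: "poly_eval (Poly_Mapping.single 0 c) v = c"
  by (simp add: poly_eval_eq_psub comm_ring_morphism.psub_single[OF comm_ring_morphism_id])

lemma homogeneous_Var: "homogeneous 1 (Var i)"
proof -
  have "mon_degree (Poly_Mapping.single i 1) = 1"
    by (simp add: mon_degree_def lookup_single when_def)
  then show ?thesis by (simp add: homogeneous_def Var_def)
qed

lemma other_indices:
  fixes k :: 3
  obtains i j where "i \<noteq> k" "j \<noteq> k" "i \<noteq> j" "UNIV = {i, j, k}"
proof -
  have U: "UNIV = {1, 2, 3 :: 3}" by (rule UNIV_3)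
  have d: "(1::3) \<noteq> 2" "(1::3) \<noteq> 3" "(2::3) \<noteq> 3" by simp_all
  consider "k = 1" | "k = 2" | "k = 3" using exhaust_3 by blast
  then show ?thesis
  proof cases
    case 1
    show ?thesis by (rule that[of 2 3]) (use U d 1 in auto)
  next
    case 2
    show ?thesis by (rule that[of 1 3]) (use U d 2 in auto)
  next
    case 3
    show ?thesis by (rule that[of 1 2]) (use U d 3 in auto)
  qed
qed

lemma single_mult_single:
  "Poly_Mapping.single 0 c * (Poly_Mapping.single 0 d * f) = Poly_Mapping.single 0 (c * d) * (f :: 'a::field poly3)"
  by (simp add: mult_single flip: mult.assoc)

text \<open>Solve l = 0 for a variable whose coefficient is nonzero. The other two variables serve
  as \<alpha> and \<beta>, and \<open>e\<close> recovers the eliminated one from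
  \<open>l\<close>.\<close>

lemma line_frame_exists_base:
  fixes l :: "'a::field poly3"
  assumes "homogeneous 1 l" "l \<noteq> 0"
  obtains u w \<alpha> \<beta> e where "line_frame l u w \<alpha> \<beta> e"
proof -
  let ?s = "Poly_Mapping.single 0 :: 'a \<Rightarrow> 'a poly3"
  obtain c where c: "l = (\<Sum>i\<in>UNIV. ?s (c i) * Var i)" using linear_form_eq[OF assms(1)] .
  have "\<exists>k. c k \<noteq> 0"
  proof (rule ccontr)
    assume "\<nexists>k. c k \<noteq> 0"
    then show False using c assms(2) by simp
  qed
  then obtain k where k: "c k \<noteq> 0" ..
  obtain i j where ij: "i \<noteq> k" "j \<noteq> k" "i \<noteq> j" "UNIV = {i, j, k}" by (rule other_indices)
  have l: "l = ?s (c i) * Var i + ?s (c j) * Var j + ?s (c k) * Var k"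
    unfolding c ij(4) using ij(1-3) by (simp add: add.assoc)
  define u where "u = (\<chi> t. if t = i then 1 else if t = k then - c i / c k else 0)"
  define w where "w = (\<chi> t. if t = j then 1 else if t = k then - c j / c k else 0)"
  define e where "e = (\<chi> t. if t = k then 1 / c k else 0)"
  have "line_frame l u w (Var i) (Var j) e"
  proof
    show "poly_eval l u = 0" "poly_eval l w = 0"
      using ij k by (simp_all add: l evaluation.add evaluation.mult u_def w_def)
    show "Var t = ?s (u $ t) * Var i + ?s (w $ t) * Var j + ?s (e $ t) * l" for t
    proof -
      have t: "t = i \<or> t = j \<or> t = k" using ij(4) by auto
      have "?s (1 / c k) * l = ?s (c i / c k) * Var i + ?s (c j / c k) * Var j + Var k"
        using k by (simp add: l distrib_left single_mult_single)
      then show ?thesis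
        using t ij(1-3) by (auto simp: u_def w_def e_def single_uminus)
    qed
  qed (use assms ij homogeneous_Var in \<open>auto simp: u_def w_def\<close>)
  then show ?thesis by (rule that)
qed

lemma line_frame_exists:
  fixes l :: "'a::field_char_0 poly3"
  assumes l: "homogeneous 1 l" "l \<noteq> 0" and J: "finite J" "\<And>j. j \<in> J \<Longrightarrow> homogeneous 1 (g j)" "\<And>j. j \<in> J \<Longrightarrow> \<not> l dvd g j"
  obtains u w \<alpha> \<beta> e where "line_frame l u w \<alpha> \<beta> e" "\<And>j. j \<in> J \<Longrightarrow> poly_eval (g j) w \<noteq> 0"
proof -
  obtain u w \<alpha> \<beta> e where "line_frame l u w \<alpha> \<beta> e" using line_frame_exists_base[OF l] .
  then interpret line_frame l u w \<alpha> \<beta> e .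
  \<comment> \<open>The roles of \<open>u\<close> and \<open>w\<close> are exchanged so that the
    parameter runs through the candidates w + a u for the point at infinity. All but finitely many
    of them avoid every line \<open>g j\<close>.\<close>
  have "line_restrict w u (g j) \<noteq> 0" if "j \<in> J" for j
    using dvd_of_restrict_eq_0[OF J(2)[OF that]] J(3)[OF that]
    by (auto simp: line_restrict_linear_form[OF J(2)[OF that]])
  then have "(\<Prod>j\<in>J. line_restrict w u (g j)) \<noteq> 0" using J(1) by simp
  then have "finite {a. poly (\<Prod>j\<in>J. line_restrict w u (g j)) a = 0}" by (rule poly_roots_finite)
  then obtain a where a: "poly (\<Prod>j\<in>J. line_restrict w u (g j)) a \<noteq> 0"
    using infinite_UNIV_char_0[where 'a = 'a] by (metis (mono_tags, lifting) UNIV_eq_I mem_Collect_eq)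
  let ?s = "Poly_Mapping.single 0 :: 'a \<Rightarrow> 'a poly3"
  \<comment> \<open>Moving \<open>w\<close> to w + a u changes \<alpha>(w) from 0 to a; subtracting
    a \<beta> repairs this and keeps \<alpha>(u) = 1.\<close>
  have "line_frame l u (w + a *s u) (\<alpha> - ?s a * \<beta>) \<beta> e"
  proof
    show "homogeneous 1 (\<alpha> - ?s a * \<beta>)"
      by (intro homogeneous_diff homogeneous_smult linear)
    show "Var i = ?s (u $ i) * (\<alpha> - ?s a * \<beta>) + ?s ((w + a *s u) $ i) * \<beta> + ?s (e $ i) * l" for i
      by (subst Var_eq[of i]) (simp add: right_diff_distrib single_mult_single distrib_right single_add mult.commute[of a])
  qed (use linear nonzero eval_l eval_\<alpha> eval_\<beta> in
      \<open>simp_all add: linear_form_eval[OF linear(1)] linear_form_eval[OF linear(2)] linear_form_eval[OF linear(3)]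
         evaluation.diff evaluation.mult\<close>)
  moreover have "poly_eval (g j) (w + a *s u) \<noteq> 0" if "j \<in> J" for j
    using a that J(1) by (auto simp: poly_prod poly_restrict)
  ultimately show ?thesis by (rule that)
qed

subsection \<open>Restricting an arrangement to one of its lines\<close>

text \<open>
  The point at infinity of the chosen line lies on no other line, so all intersections with the
  lines \<open>g j\<close> are at finite parameters \<open>root j\<close>.
\<close>

locale framed_arrangement = line_frame l u w \<alpha> \<beta> e
  for l :: "'a::field_char_0 poly3" and u w \<alpha> \<beta> e +
  fixes T :: "'i set" and g :: "'i \<Rightarrow> 'a poly3"
  assumes fin: "finite T"
    and lin: "j \<in> T \<Longrightarrow> homogeneous 1 (g j)"
    and eval_w: "j \<in> T \<Longrightarrow> poly_eval (g j) w \<noteq> 0"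
begin

definition root :: "'i \<Rightarrow> 'a"
  where "root j = - poly_eval (g j) u / poly_eval (g j) w"

definition mult :: "'a \<Rightarrow> nat"
  where "mult a = card {j \<in> T. root j = a}"

abbreviation "B \<equiv> root ` T"

definition L :: "'a poly"
  where "L = (\<Prod>a\<in>B. [:- a, 1:])"

text \<open>The factor common to the restrictions of all generators of the ideal of
  \<open>T\<close>: omitting one line leaves a zero of order at least \<open>mult a - 1\<close> at
  \<open>a\<close>.\<close>

definition G :: "'a poly"
  where "G = (\<Prod>a\<in>B. [:- a, 1:] ^ (mult a - 1))"

lemma line_restrict_g: "j \<in> T \<Longrightarrow> line_restrict u w (g j) = smult (poly_eval (g j) w) [:- root j, 1:]"
  using eval_w[of j] by (simp add: line_restrict_linear_form[OF lin] root_def)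

lemma card_vanishing: "card {j \<in> T. poly_eval (g j) (u + a *s w) = 0} = mult a"
proof -
  have "poly_eval (g j) (u + a *s w) = 0 \<longleftrightarrow> root j = a" if "j \<in> T" for j
    using eval_w[OF that] poly_restrict[of u w "g j" a] line_restrict_g[OF that] by auto
  then have "{j \<in> T. poly_eval (g j) (u + a *s w) = 0} = {j \<in> T. root j = a}" by auto
  then show ?thesis by (simp add: mult_def)
qed

lemma mult_pos: "a \<in> B \<Longrightarrow> 0 < mult a"
  using fin by (auto simp: mult_def card_gt_0_iff)

lemma prod_root: "(\<Prod>j\<in>T. [:- root j, 1:]) = (\<Prod>a\<in>B. [:- a, 1:] ^ mult a)"
proof -
  have "(\<Prod>j\<in>T. [:- root j, 1:]) = (\<Prod>a\<in>B. \<Prod>j\<in>{j \<in> T. root j = a}. [:- root j, 1:])"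
    by (rule prod.image_gen[OF fin])
  also have "\<dots> = (\<Prod>a\<in>B. [:- a, 1:] ^ mult a)"
    by (intro prod.cong) (auto simp: mult_def)
  finally show ?thesis .
qed

lemma GL: "G * L = (\<Prod>j\<in>T. [:- root j, 1:])"
proof -
  have "[:- a, 1:] ^ (mult a - 1) * [:- a, 1:] = [:- a, 1:] ^ mult a" if "a \<in> B" for a
    using mult_pos[OF that] by (cases "mult a") (auto simp: mult_ac simp del: mult_pCons_left mult_pCons_right)
  then show ?thesis
    unfolding prod_root G_def L_def prod.distrib[symmetric] by (intro prod.cong) auto
qed

lemma degree_L: "degree L = card B"
  using degree_prod_linear[of "\<lambda>a. a" B] by (simp add: L_def)

lemma L_nonzero: "L \<noteq> 0" and G_nonzero: "G \<noteq> 0"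
  using fin by (auto simp: L_def G_def)

lemma degree_G: "degree G + card B = card T"
  using degree_prod_linear[of root T] by (simp add: GL[symmetric] degree_mult_eq L_nonzero G_nonzero degree_L)

lemma line_restrict_prod:
  assumes "A \<subseteq> T"
  obtains c where "c \<noteq> 0" "line_restrict u w (prod g A) = smult c (\<Prod>j\<in>A. [:- root j, 1:])"
proof
  have "(\<Prod>j\<in>A. line_restrict u w (g j)) = (\<Prod>j\<in>A. smult (poly_eval (g j) w) [:- root j, 1:])"
    using assms by (intro prod.cong line_restrict_g) auto
  then show "line_restrict u w (prod g A) = smult (\<Prod>j\<in>A. poly_eval (g j) w) (\<Prod>j\<in>A. [:- root j, 1:])"
    by (simp only: line_restrict.prod prod_smult)
  show "(\<Prod>j\<in>A. poly_eval (g j) w) \<noteq> 0"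
    using finite_subset[OF assms fin] assms eval_w by auto
qed

lemma homogeneous_prod_g: "A \<subseteq> T \<Longrightarrow> homogeneous (card A) (prod g A)"
  using homogeneous_prod[of A "\<lambda>_. 1" g] lin by auto

text \<open>The required order \<open>k\<close> is an arbitrary function of the number of lines of
  \<open>T\<close> through the point, because the lifting argument asks for r p - k and the Bezout
  argument for m p.\<close>

lemma prod_power_dvd_restrict:
  assumes "\<And>v. v \<noteq> 0 \<Longrightarrow> poly_eval l v = 0 \<Longrightarrow>
    vanishes_to_order v (k (card {j \<in> T. poly_eval (g j) v = 0})) f"
  shows "(\<Prod>a\<in>B. [:- a, 1:] ^ k (mult a)) dvd line_restrict u w f"
proof (rule prod_linear_power_dvd)
  fix a
  have "poly_eval l (u + a *s w) = 0"
    by (simp add: linear_form_eval[OF linear(1)] eval_l)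
  then show "[:- a, 1:] ^ k (mult a) dvd line_restrict u w f"
    using assms[OF point_nonzero] by (intro vanishes_to_order_restrict) (simp add: card_vanishing)
qed (use fin in auto)

end

section \<open>Ideals generated by fold products, and their powers\<close>

definition fold_ideal :: "'i set \<Rightarrow> ('i \<Rightarrow> 'a::field poly3) \<Rightarrow> 'a poly3 set"
  where "fold_ideal S g = Idl\<^bsub>polyR\<^esub> ((\<lambda>i. prod g (S - {i})) ` S)"

abbreviation irr_fold :: "nat \<Rightarrow> nat \<Rightarrow> 'i set \<Rightarrow> ('i \<Rightarrow> 'a::field poly3) \<Rightarrow> 'a poly3 set"
  where "irr_fold e k S g \<equiv> idpow irrelevant_ideal e \<cdot>\<^bsub>polyR\<^esub> idpow (fold_ideal S g) k"

lemma fold_ideal_ideal: "ideal (fold_ideal S g) polyR"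
  unfolding fold_ideal_def by (rule ideal_type_genideal)

lemma irrelevant_ideal_ideal: "ideal irrelevant_ideal polyR"
  unfolding irrelevant_ideal_def by (rule ideal_type_genideal)

lemma irr_fold_ideal: "ideal (irr_fold e k S g) polyR"
  by (intro ideal_prod_type_ideal idpow_ideal fold_ideal_ideal irrelevant_ideal_ideal)

lemma fold_ideal_mem: "i \<in> S \<Longrightarrow> prod g (S - {i}) \<in> fold_ideal S g"
  unfolding fold_ideal_def by (rule genideal_type_mem) auto

lemma irr_fold_mult:
  assumes "y \<in> irr_fold e k S g" "p \<in> idpow (fold_ideal S g) i"
  shows "p * y \<in> irr_fold e (i + k) S g"
  using assms(1)
proof (induction rule: ideal_prod_type_induct)
  case (mult x y)
  then show ?case
    using ideal_prod_type_mem[OF mult(1) idpow_mult[OF fold_ideal_ideal assms(2) mult(2)]] by (simp add: mult_ac)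
qed (simp add: distrib_left ideal_type_add[OF irr_fold_ideal])

lemma irr_fold_scale:
  assumes "\<And>x. x \<in> fold_ideal T g \<Longrightarrow> a * x \<in> fold_ideal S g" "y \<in> irr_fold e k T g"
  shows "a ^ k * y \<in> irr_fold e k S g"
  using assms(2)
proof (induction rule: ideal_prod_type_induct)
  case (mult x y)
  then show ?case
    using ideal_prod_type_mem[OF mult(1) idpow_scale[OF assms(1) fold_ideal_ideal mult(2)]] by (simp add: mult_ac)
qed (simp add: distrib_left ideal_type_add[OF irr_fold_ideal])

lemma fold_ideal_insert:
  assumes "finite T" "i \<notin> T" "x \<in> fold_ideal T g"
  shows "g i * x \<in> fold_ideal (insert i T) g"
proof -
  have "ideal {x. g i * x \<in> fold_ideal (insert i T) g} polyR"
    using fold_ideal_ideal[of "insert i T" g] unfolding ideal_type_iff by (simp add: distrib_left mult.left_commute)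
  moreover have "g i * prod g (T - {j}) \<in> fold_ideal (insert i T) g" if "j \<in> T" for j
  proof -
    have "insert i T - {j} = insert i (T - {j})" using that assms by auto
    then show ?thesis using fold_ideal_mem[of j "insert i T" g] that assms by simp
  qed
  ultimately have "fold_ideal T g \<subseteq> {x. g i * x \<in> fold_ideal (insert i T) g}"
    unfolding fold_ideal_def[of T] by (intro genideal_type_subset) auto
  then show ?thesis using assms(3) by blast
qed

text \<open>Omitting one factor removes at most one line through \<open>v\<close>, which gives the
  order of each generator. It is applied to the lifts, so that subtracting one keeps the orders
  required of f.\<close>

lemma irr_fold_vanishes:
  assumes T: "finite T" "\<And>j. j \<in> T \<Longrightarrow> homogeneous 1 (g j)" and y: "y \<in> irr_fold e k T g"
  shows "vanishes_to_order v (k * (card {j \<in> T. poly_eval (g j) v = 0} - 1)) y"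
proof -
  let ?n = "card {j \<in> T. poly_eval (g j) v = 0}"
  have "[:0, 1:] ^ (?n - 1) dvd taylor v x" if "x \<in> fold_ideal T g" for x
  proof (rule genideal_dvd[OF taylor.comm_ring_morphism_axioms _ that[unfolded fold_ideal_def]])
    fix x assume "x \<in> (\<lambda>i. prod g (T - {i})) ` T"
    then obtain i where i: "i \<in> T" "x = prod g (T - {i})" by auto
    have "vanishes_to_order v (card {j \<in> T - {i}. poly_eval (g j) v = 0}) x"
      unfolding i(2) using T by (intro vanishes_to_order_prod) auto
    moreover have "?n - 1 \<le> card {j \<in> T - {i}. poly_eval (g j) v = 0}"
    proof -
      have "{j \<in> T - {i}. poly_eval (g j) v = 0} = {j \<in> T. poly_eval (g j) v = 0} - {i}" by auto
      then show ?thesis by (simp add: card_Diff_singleton_if)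
    qed
    ultimately show "[:0, 1:] ^ (?n - 1) dvd taylor v x"
      using vanishes_to_order_mono unfolding vanishes_to_order_def by blast
  qed
  then have *: "vanishes_to_order v (k * (?n - 1)) x" if "x \<in> idpow (fold_ideal T g) k" for x
    using idpow_dvd[OF taylor.comm_ring_morphism_axioms _ that, of "[:0, 1:] ^ (?n - 1)" v]
    by (simp add: vanishes_to_order_def mult.commute flip: power_mult)
  from y show ?thesis
  proof (induction rule: ideal_prod_type_induct)
    case (mult x y)
    then show ?case by (intro vanishes_to_order_mult_right *)
  qed (rule vanishes_to_order_add)
qed

context framed_arrangement
begin

text \<open>
  Modulo \<open>l\<close>, the ideal of \<open>T\<close> is \<open>G\<close> times all forms of degree at least \<open>card B - 1\<close>, by Lagrange
  interpolation at the points of \<open>B\<close>.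
\<close>

lemma lift_restriction:
  assumes "T \<noteq> {}" "e' \<le> d"
  shows "degree q \<le> k * (card B - 1) + d \<Longrightarrow>
    \<exists>y. homogeneous (k * (card T - 1) + d) y \<and> line_restrict u w y = G ^ k * q \<and> y \<in> irr_fold e' k T g"
proof (induction k arbitrary: q)
  case 0
  \<comment> \<open>For k = 0 the degree of \<open>q\<close> is at most d, so \<open>q\<close> can
    be homogenised to degree d in \<alpha> and \<beta>; a form of degree d lies in M^e' as e' <=
    d.\<close>
  define y where "y = (\<Sum>i\<le>d. Poly_Mapping.single 0 (coeff q i) * (\<alpha> ^ (d - i) * \<beta> ^ i))"
  have "homogeneous d (\<alpha> ^ (d - i) * \<beta> ^ i)" if "i \<le> d" for i
    using homogeneous_mult[OF homogeneous_power[OF linear(2), of "d - i"] homogeneous_power[OF linear(3), of i]] that by simp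
  then have hom: "homogeneous d y"
    unfolding y_def by (intro homogeneous_sum homogeneous_smult) auto
  have "line_restrict u w y = (\<Sum>i\<le>d. monom (coeff q i) i)"
    by (simp add: y_def line_restrict.sum line_restrict.mult line_restrict.power line_restrict_frame monom_altdef)
  also have "\<dots> = q"
    using 0 by (intro poly_as_sum_of_monoms') simp
  finally have "line_restrict u w y = q" .
  moreover have "y \<in> irr_fold e' 0 T g"
    using ideal_prod_type_mem[OF homogeneous_in_irrelevant_power[OF hom assms(2)], of 1] by (simp add: idpow_0)
  ultimately show ?case using hom by auto
next
  case (Suc k)
  define D where "D = k * (card B - 1) + d"
  \<comment> \<open>\<open>P\<close> is additive, so it suffices to reach Lagrange numerators times
    polynomials of degree at most \<open>D\<close>, the bound in the induction hypothesis.\<close>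
  define P where "P q \<longleftrightarrow> (\<exists>y. homogeneous (Suc k * (card T - 1) + d) y \<and>
    line_restrict u w y = G ^ Suc k * q \<and> y \<in> irr_fold e' (Suc k) T g)" for q
  have finB: "finite B" using fin by simp
  have P_0: "P 0"
    unfolding P_def by (intro exI[of _ 0]) (simp add: line_restrict.zero ideal_type_zero[OF irr_fold_ideal])
  have P_add: "P (p + q)" if "P p" "P q" for p q
  proof -
    from that obtain y z where "homogeneous (Suc k * (card T - 1) + d) y" "line_restrict u w y = G ^ Suc k * p"
        "y \<in> irr_fold e' (Suc k) T g" "homogeneous (Suc k * (card T - 1) + d) z" "line_restrict u w z = G ^ Suc k * q"
        "z \<in> irr_fold e' (Suc k) T g"
      unfolding P_def by blast
    then show ?thesis
      unfolding P_def
      by (intro exI[of _ "y + z"]) (auto simp: line_restrict.add distrib_left homogeneous_add ideal_type_add[OF irr_fold_ideal] simp del: power_Suc)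
  qed
  have P_basic: "P ((\<Prod>b\<in>B - {a}. [:- b, 1:]) * q)" if a: "a \<in> B" and q: "degree q \<le> D" for a q
  proof -
    \<comment> \<open>Choose a line through \<open>a\<close>: the product of the others restricts to
      \<open>G\<close> times the Lagrange numerator of \<open>a\<close>, up to the constant
      \<open>c\<close>.\<close>
    obtain j where j: "j \<in> T" "root j = a" using a by auto
    obtain c where c: "c \<noteq> 0" "line_restrict u w (prod g (T - {j})) = smult c (\<Prod>j\<in>T - {j}. [:- root j, 1:])"
      using line_restrict_prod[of "T - {j}"] by auto
    have "[:- a, 1:] * (\<Prod>j\<in>T - {j}. [:- root j, 1:]) = [:- a, 1:] * (G * (\<Prod>b\<in>B - {a}. [:- b, 1:]))"
      using GL prod.remove[OF fin j(1), of "\<lambda>j. [:- root j, 1:]"] prod.remove[OF finB a, of "\<lambda>b. [:- b, 1:]"]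
      unfolding L_def j(2) by (simp only: mult_ac)
    then have G: "(\<Prod>j\<in>T - {j}. [:- root j, 1:]) = G * (\<Prod>b\<in>B - {a}. [:- b, 1:])"
      by (subst (asm) mult_left_cancel) auto
    have "degree (smult (inverse c) q) \<le> D" using q degree_smult_le le_trans by blast
    then obtain y where y: "homogeneous (k * (card T - 1) + d) y"
        "line_restrict u w y = G ^ k * smult (inverse c) q" "y \<in> irr_fold e' k T g"
      using Suc.IH unfolding D_def by blast
    let ?p = "prod g (T - {j})"
    have "homogeneous (card T - 1) ?p"
      using homogeneous_prod_g[of "T - {j}"] j(1) by (simp add: card_Diff_singleton)
    then have "homogeneous (Suc k * (card T - 1) + d) (?p * y)"
      using homogeneous_mult[OF _ y(1)] by (simp add: add.assoc)
    moreover have "line_restrict u w (?p * y) = G ^ Suc k * ((\<Prod>b\<in>B - {a}. [:- b, 1:]) * q)"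
      using c(1) by (simp add: line_restrict.mult c(2) y(2) G mult_ac)
    moreover have "?p * y \<in> irr_fold e' (Suc k) T g"
      using irr_fold_mult[OF y(3), of ?p 1] idpow_power[OF fold_ideal_mem[OF j(1), of g], of 1] by simp
    ultimately show ?thesis unfolding P_def by blast
  qed
  obtain a0 where a0: "a0 \<in> B" using assms(1) by auto
  have "card B > 0" using a0 finB by (auto simp: card_gt_0_iff)
  \<comment> \<open>The remainder has degree below \<open>card B\<close> and is interpolated with
    constant cofactors. The multiple of \<open>L\<close> is a single numerator, that of
    \<open>a0\<close>, times (t - a0) h, whose degree is at most \<open>D\<close>.\<close>
  define h r where "h = q div L" and "r = q mod L"
  have qhr: "q = L * h + r" by (simp add: h_def r_def)
  have r: "degree r < card B" using degree_mod_less'[of L q] \<open>card B > 0\<close> L_nonzero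
    by (cases "r = 0") (auto simp: r_def degree_L)
  have "P (L * h)"
  proof (cases "h = 0")
    case False
    then have Lh: "degree (L * h) = card B + degree h" by (simp add: degree_mult_eq L_nonzero degree_L)
    then have "degree q = card B + degree h" using r qhr by (simp add: degree_add_eq_left)
    then have "degree ([:- a0, 1:] * h) \<le> D"
      using Suc.prems False \<open>card B > 0\<close> by (simp add: D_def degree_mult_eq del: mult_pCons_left)
    moreover have "L * h = (\<Prod>b\<in>B - {a0}. [:- b, 1:]) * ([:- a0, 1:] * h)"
      using prod.remove[OF finB a0, of "\<lambda>b. [:- b, 1:]"] unfolding L_def by (simp only: mult_ac)
    ultimately show ?thesis using P_basic[OF a0] by metis
  qed (simp add: P_0)
  moreover have "P r"
  proof -
    have "P (\<Sum>a\<in>A. smult (f a) (\<Prod>b\<in>B - {a}. [:- b, 1:]))" if "A \<subseteq> B" for A f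
      using finite_subset[OF that finB] that
    proof induction
      case (insert a A)
      have "P ((\<Prod>b\<in>B - {a}. [:- b, 1:]) * [:f a:])"
        using insert.prems by (intro P_basic) auto
      then show ?case using insert by (simp add: P_add)
    qed (simp add: P_0)
    from this[OF order_refl, of "\<lambda>a. poly r a / (\<Prod>b\<in>B - {a}. a - b)"] show ?thesis
      by (simp only: lagrange_interpolation[OF finB r, symmetric])
  qed
  ultimately have "P q" unfolding qhr by (rule P_add)
  then show ?case unfolding P_def .
qed

end

text \<open>Distinctness is expressed by divisibility because the lines act as pairwise
  non-associated primes when they are divided out of a form.\<close>

definition distinct_lines :: "'i set \<Rightarrow> ('i \<Rightarrow> 'a::field poly3) \<Rightarrow> bool"
  where "distinct_lines S g \<longleftrightarrow> finite S \<and>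
    (\<forall>i\<in>S. homogeneous 1 (g i) \<and> g i \<noteq> 0 \<and> (\<forall>j\<in>S. i \<noteq> j \<longrightarrow> \<not> g i dvd g j))"

lemma distinct_linesD:
  assumes "distinct_lines S g"
  shows "finite S" "i \<in> S \<Longrightarrow> homogeneous 1 (g i)" "i \<in> S \<Longrightarrow> g i \<noteq> 0"
    "i \<in> S \<Longrightarrow> j \<in> S \<Longrightarrow> i \<noteq> j \<Longrightarrow> \<not> g i dvd g j"
  using assms unfolding distinct_lines_def by blast+

lemma distinct_lines_subset: "distinct_lines S g \<Longrightarrow> T \<subseteq> S \<Longrightarrow> distinct_lines T g"
  unfolding distinct_lines_def by (auto intro: finite_subset)

text \<open>Order conditions with \<open>point_mult S g v - 1\<close> can be imposed at every
  nonzero vector: truncated subtraction makes them void where fewer than two lines meet.\<close>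

definition point_mult :: "'i set \<Rightarrow> ('i \<Rightarrow> 'a::field poly3) \<Rightarrow> 'a ^ 3 \<Rightarrow> nat"
  where "point_mult S g v = card {j \<in> S. poly_eval (g j) v = 0}"

lemma point_mult_insert:
  assumes "finite T" "i \<notin> T"
  shows "point_mult (insert i T) g v = (if poly_eval (g i) v = 0 then Suc (point_mult T g v) else point_mult T g v)"
proof -
  have "{j \<in> insert i T. poly_eval (g j) v = 0} =
    (if poly_eval (g i) v = 0 then insert i {j \<in> T. poly_eval (g j) v = 0} else {j \<in> T. poly_eval (g j) v = 0})"
    by auto
  then show ?thesis using assms by (simp add: point_mult_def)
qed

lemma framed_arrangement_exists:
  fixes g :: "'i \<Rightarrow> 'a::field_char_0 poly3"
  assumes "distinct_lines S g" "i \<in> S"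
  obtains u w \<alpha> \<beta> e where "framed_arrangement (g i) u w \<alpha> \<beta> e (S - {i}) g"
proof -
  note S = distinct_linesD[OF assms(1)]
  have T: "finite (S - {i})" "\<And>j. j \<in> S - {i} \<Longrightarrow> homogeneous 1 (g j)" "\<And>j. j \<in> S - {i} \<Longrightarrow> \<not> g i dvd g j"
    using S assms(2) by auto
  show ?thesis
  proof (rule line_frame_exists[OF S(2,3)[OF assms(2)] T])
    fix u w \<alpha> \<beta> e
    assume "line_frame (g i) u w \<alpha> \<beta> e" "\<And>j. j \<in> S - {i} \<Longrightarrow> poly_eval (g j) w \<noteq> 0"
    then have "framed_arrangement (g i) u w \<alpha> \<beta> e (S - {i}) g"
      using S unfolding framed_arrangement_def framed_arrangement_axioms_def by auto
    then show thesis by (rule that)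
  qed
qed

subsection \<open>Fat point conditions imply membership in the power\<close>

lemma (in framed_arrangement) divide_restriction:
  assumes T: "T \<noteq> {}" and k: "k \<le> r" and e: "e' \<le> d"
    and f: "homogeneous (r * card T + d - k) f"
    and van: "\<And>v. v \<noteq> 0 \<Longrightarrow> poly_eval l v = 0 \<Longrightarrow> vanishes_to_order v (r * point_mult T g v - k) f"
  obtains y where "homogeneous (r * card T + d - k) (prod g T ^ (r - k) * y)" "y \<in> irr_fold e' k T g"
    "l dvd f - prod g T ^ (r - k) * y"
proof -
  have "card B > 0" using T fin by (auto simp: card_gt_0_iff)
  have "card T > 0" using T fin by (auto simp: card_gt_0_iff)
  have "(\<Prod>a\<in>B. [:- a, 1:] ^ (r * mult a - k)) dvd line_restrict u w f"
    using van unfolding point_mult_def by (rule prod_power_dvd_restrict)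
  also have "(\<Prod>a\<in>B. [:- a, 1:] ^ (r * mult a - k)) = (G * L) ^ (r - k) * G ^ k"
  proof -
    have "r * mult a - k = mult a * (r - k) + (mult a - 1) * k" if a: "a \<in> B" for a
    proof -
      obtain m where m: "mult a = Suc m" using mult_pos[OF a] by (cases "mult a") auto
      obtain t where t: "r = k + t" using k le_Suc_ex by blast
      show ?thesis by (simp add: m t algebra_simps)
    qed
    then have "(\<Prod>a\<in>B. [:- a, 1:] ^ (r * mult a - k)) = (\<Prod>a\<in>B. ([:- a, 1:] ^ mult a) ^ (r - k) * ([:- a, 1:] ^ (mult a - 1)) ^ k)"
      by (intro prod.cong) (simp_all add: power_add flip: power_mult)
    also have "\<dots> = (\<Prod>a\<in>B. [:- a, 1:] ^ mult a) ^ (r - k) * (\<Prod>a\<in>B. [:- a, 1:] ^ (mult a - 1)) ^ k"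
      by (simp add: prod.distrib prod_power_distrib)
    moreover have "(\<Prod>a\<in>B. [:- a, 1:] ^ mult a) = G * L" by (simp only: GL prod_root)
    ultimately show ?thesis by (simp only: G_def)
  qed
  finally obtain q where q: "line_restrict u w f = (G * L) ^ (r - k) * G ^ k * q" ..
  obtain c where c: "c \<noteq> 0" "line_restrict u w (prod g T) = smult c (G * L)"
    using line_restrict_prod[OF order_refl] unfolding GL by blast
  \<comment> \<open>As deg G + card B = card T, removing (G L)^(r-k) and G^k from degree r card T +
    d - k leaves k card B - k + d.\<close>
  have "degree q \<le> k * (card B - 1) + d"
  proof (cases "q = 0")
    case False
    obtain b where b: "card B = Suc b" using \<open>card B > 0\<close> by (cases "card B") auto
    obtain t where t: "r = k + t" using k le_Suc_ex by blast
    have "degree (G * L) = card T"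
      using degree_G by (simp add: degree_mult_eq L_nonzero G_nonzero degree_L)
    moreover have "degree ((G * L) ^ t) = t * degree (G * L)" "degree (G ^ k) = k * degree G"
      by (simp_all add: degree_power_eq L_nonzero G_nonzero)
    moreover have "degree ((G * L) ^ t * G ^ k * q) = degree ((G * L) ^ t) + degree (G ^ k) + degree q"
      using False L_nonzero G_nonzero by (subst degree_mult_eq, simp, simp, subst degree_mult_eq) auto
    ultimately have "degree (line_restrict u w f) = t * card T + k * degree G + degree q"
      unfolding q t by simp
    moreover have degG: "degree G + Suc b = card T" using degree_G b by simp
    moreover have "degree (line_restrict u w f) \<le> r * card T + d - k" by (rule degree_restrict_le[OF f])
    moreover have "k * card T = k * degree G + k * b + k"
      using degG by (metis add_Suc_right add_mult_distrib2 mult_Suc_right add.commute add.assoc)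
    ultimately show ?thesis using b t by (simp add: add_mult_distrib)
  qed simp
  then have "degree (smult (inverse (c ^ (r - k))) q) \<le> k * (card B - 1) + d"
    using degree_smult_le le_trans by blast
  from lift_restriction[OF T e this] obtain y where y: "homogeneous (k * (card T - 1) + d) y"
    "line_restrict u w y = G ^ k * smult (inverse (c ^ (r - k))) q" "y \<in> irr_fold e' k T g" by blast
  have "k * (card T - 1) + k = k * card T" using \<open>card T > 0\<close> by (cases "card T") auto
  moreover have "r * card T = (r - k) * card T + k * card T" using k by (simp flip: add_mult_distrib)
  ultimately have "(r - k) * card T + (k * (card T - 1) + d) = r * card T + d - k" by linarith
  then have h: "homogeneous (r * card T + d - k) (prod g T ^ (r - k) * y)"
    using homogeneous_mult[OF homogeneous_power[OF homogeneous_prod_g[OF order_refl], of "r - k"] y(1)] by simp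
  have "line_restrict u w (prod g T ^ (r - k) * y) = line_restrict u w f"
    using c(1) by (simp add: line_restrict.mult line_restrict.power c(2) y(2) q smult_power power_inverse mult_ac)
  then have "l dvd f - prod g T ^ (r - k) * y"
    by (intro dvd_of_restrict_eq_0[OF homogeneous_diff[OF f h]]) (simp add: line_restrict.diff)
  then show ?thesis using that h y(3) by blast
qed

lemma irr_fold_insert:
  assumes "finite T" "i \<notin> T" "y \<in> irr_fold e k T g"
  shows "g i ^ k * y \<in> irr_fold e k (insert i T) g"
  by (rule irr_fold_scale[OF _ assms(3)]) (rule fold_ideal_insert[OF assms(1,2)])

theorem fat_points_in_power:
  fixes g :: "'i \<Rightarrow> 'a::field_char_0 poly3"
  assumes "distinct_lines S g" "S \<noteq> {}" "e \<le> d"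
    and "homogeneous (r * (card S - 1) + d) f"
    and "\<And>v. v \<noteq> 0 \<Longrightarrow> vanishes_to_order v (r * (point_mult S g v - 1)) f"
  shows "f \<in> irr_fold e r S g"
proof -
  have "finite S" using assms(1) by (rule distinct_linesD)
  then show ?thesis using assms(2,1,4,5)
  proof (induction S arbitrary: f rule: finite_ne_induct)
    case (singleton i)
    \<comment> \<open>For one line the empty product makes the ideal the whole ring, and r(card S -
      1) = 0, so only the degree of f matters.\<close>
    have "1 \<in> fold_ideal {i} g" using fold_ideal_mem[of i "{i}" g] by simp
    from idpow_power[OF this, of r] show ?case
      using ideal_prod_type_mem[OF homogeneous_in_irrelevant_power[of d f e]] singleton assms(3) by fastforce
  next
    case (insert i T)
    let ?S = "insert i T"
    note S = distinct_linesD[OF insert.prems(1)]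
    have T: "distinct_lines T g" by (rule distinct_lines_subset[OF insert.prems(1)]) auto
    have cardT: "card T > 0" using insert.hyps by (simp add: card_gt_0_iff)
    have rT: "r * card T \<ge> r" using cardT by simp
    have "?S - {i} = T" using insert.hyps by auto
    obtain u w \<alpha> \<beta> e0 where "framed_arrangement (g i) u w \<alpha> \<beta> e0 (?S - {i}) g"
      using framed_arrangement_exists[OF insert.prems(1) insertI1] .
    then interpret framed_arrangement "g i" u w \<alpha> \<beta> e0 T g
      by (simp only: \<open>?S - {i} = T\<close>)
    have mult_S: "point_mult ?S g v = (if poly_eval (g i) v = 0 then Suc (point_mult T g v) else point_mult T g v)" for v
      by (rule point_mult_insert) (use insert.hyps in auto)
    \<comment> \<open>A form whose orders on the line \<open>g i = 0\<close> are too small by \<open>k\<close>; the case \<open>k = r\<close> is the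
      induction hypothesis for \<open>T\<close>, and \<open>k\<close> increases by one with each division by \<open>g i\<close>.\<close>
    have "g i ^ k * f \<in> irr_fold e r ?S g"
      if "k \<le> r" "homogeneous (r * card T + d - k) f"
        "\<And>v. v \<noteq> 0 \<Longrightarrow> vanishes_to_order v (r * (point_mult ?S g v - 1) - (if poly_eval (g i) v = 0 then k else 0)) f"
      for k f
      using that
    proof (induction k arbitrary: f rule: inc_induct)
      case base
      have "f \<in> irr_fold e r T g"
      proof (rule insert.IH[OF T])
        have "r * (card T - 1) + d = r * card T + d - r"
          using rT by (simp add: diff_mult_distrib2)
        then show "homogeneous (r * (card T - 1) + d) f" using base by simp
        \<comment> \<open>On the removed line the count for \<open>T\<close> is one smaller, which
          the r divisions exactly absorb; off that line the two counts agree.\<close>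
        show "vanishes_to_order v (r * (point_mult T g v - 1)) f" if "v \<noteq> 0" for v
          using base(2)[OF that] by (auto simp: mult_S diff_mult_distrib2 split: if_splits)
      qed
      then show ?case
        by (rule irr_fold_insert[OF insert.hyps(1,3)])
    next
      case (step k)
      let ?F = "prod g T"
      have kr: "k \<le> r" using step.hyps by simp
      have "vanishes_to_order v (r * point_mult T g v - k) f" if "v \<noteq> 0" "poly_eval (g i) v = 0" for v
        using step.prems(2)[OF that(1)] that(2) by (simp add: mult_S)
      from divide_restriction[OF insert.hyps(2) kr assms(3) step.prems(1) this]
      obtain y where y: "homogeneous (r * card T + d - k) (?F ^ (r - k) * y)" "y \<in> irr_fold e k T g"
        "g i dvd f - ?F ^ (r - k) * y" by blast
      let ?h = "?F ^ (r - k) * y"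
      have hom: "homogeneous (r * card T + d - k) (f - ?h)" by (rule homogeneous_diff[OF step.prems(1) y(1)])
      obtain f' where f': "f - ?h = g i * f'" "homogeneous (r * card T + d - Suc k) f'"
      proof (cases "f - ?h = 0")
        case True
        then show ?thesis using that[of 0] by simp
      next
        case False
        from homogeneous_dvd[OF S(2,3) hom False y(3)] show ?thesis using that by (auto simp: Suc_diff_Suc)
      qed
      \<comment> \<open>The subtracted lift meets the same conditions as f: with p lines of
        \<open>T\<close> through v its order is at least (r - k) p + k (p - 1), which is r p - k on
        the line if p >= 1 and at least r (p - 1) off it.\<close>
      have h_van: "vanishes_to_order v (r * (point_mult ?S g v - 1) - (if poly_eval (g i) v = 0 then k else 0)) ?h" for v
      proof -
        have "vanishes_to_order v ((r - k) * point_mult T g v + k * (point_mult T g v - 1)) ?h"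
          unfolding point_mult_def
          by (intro vanishes_to_order_mult vanishes_to_order_power vanishes_to_order_prod irr_fold_vanishes[OF _ _ y(2)])
             (use fin lin in auto)
        moreover have "r * (point_mult ?S g v - 1) - (if poly_eval (g i) v = 0 then k else 0) \<le>
          (r - k) * point_mult T g v + k * (point_mult T g v - 1)"
        proof -
          obtain t where t: "r = k + t" using kr le_Suc_ex by blast
          show ?thesis by (cases "point_mult T g v") (simp_all add: mult_S t algebra_simps)
        qed
        ultimately show ?thesis by (rule vanishes_to_order_mono)
      qed
      have "g i ^ Suc k * f' \<in> irr_fold e r ?S g"
      proof (rule step.IH[OF f'(2)])
        fix v :: "'a ^ 3" assume v: "v \<noteq> 0"
        have "vanishes_to_order v (r * (point_mult ?S g v - 1) - (if poly_eval (g i) v = 0 then k else 0)) (g i * f')"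
          unfolding f'(1)[symmetric] by (intro vanishes_to_order_diff h_van step.prems(2) v)
        from vanishes_to_order_divide_linear_form[OF S(2,3) this]
        show "vanishes_to_order v (r * (point_mult ?S g v - 1) - (if poly_eval (g i) v = 0 then Suc k else 0)) f'"
          by (auto split: if_splits)
      qed
      moreover have "g i ^ k * ?h \<in> irr_fold e r ?S g"
      proof -
        have "?F \<in> fold_ideal ?S g"
          using fold_ideal_mem[of i ?S g] \<open>?S - {i} = T\<close> by simp
        moreover have "g i ^ k * y \<in> irr_fold e k ?S g"
          by (rule irr_fold_insert[OF insert.hyps(1,3) y(2)])
        ultimately have "?F ^ (r - k) * (g i ^ k * y) \<in> irr_fold e (r - k + k) ?S g"
          by (intro irr_fold_mult idpow_power)
        then show ?thesis using kr by (simp add: mult_ac)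
      qed
      moreover have "g i ^ k * f = g i ^ Suc k * f' + g i ^ k * ?h"
      proof -
        have "f = g i * f' + ?h" using f'(1) by (simp add: algebra_simps)
        then have "g i ^ k * f = g i ^ k * (g i * f' + ?h)" by (rule arg_cong)
        then show ?thesis by (simp add: distrib_left mult_ac)
      qed
      ultimately show ?case using ideal_type_add[OF irr_fold_ideal] by metis
    qed
    from this[of 0 f] show ?case using insert.prems insert.hyps by simp
  qed
qed

subsection \<open>Degrees of forms satisfying the fat point conditions\<close>

text \<open>Where p other lines meet the line \<open>i\<close>, f has order at least m p. These p
  add up to card S - 1, so a nonzero restriction would have more zeros than its degree
  allows.\<close>

lemma fat_points_dvd:
  fixes g :: "'i \<Rightarrow> 'a::field_char_0 poly3"
  assumes S: "distinct_lines S g" "i \<in> S" and f: "homogeneous d f" "d < m * (card S - 1)"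
    and van: "\<And>v. v \<noteq> 0 \<Longrightarrow> vanishes_to_order v (m * (point_mult S g v - 1)) f"
  shows "g i dvd f"
proof -
  let ?T = "S - {i}"
  obtain u w \<alpha> \<beta> e where "framed_arrangement (g i) u w \<alpha> \<beta> e ?T g"
    using framed_arrangement_exists[OF S] .
  then interpret framed_arrangement "g i" u w \<alpha> \<beta> e ?T g .
  have "vanishes_to_order v (m * point_mult ?T g v) f" if "v \<noteq> 0" "poly_eval (g i) v = 0" for v
    using van[OF that(1)] point_mult_insert[OF fin, of i g v] that(2) S(2) by (simp add: insert_absorb)
  then have "(\<Prod>a\<in>B. [:- a, 1:] ^ (m * mult a)) dvd line_restrict u w f"
    unfolding point_mult_def by (rule prod_power_dvd_restrict)
  also have "(\<Prod>a\<in>B. [:- a, 1:] ^ (m * mult a)) = (\<Prod>j\<in>?T. [:- root j, 1:]) ^ m"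
    by (simp add: prod_root prod_power_distrib mult.commute flip: power_mult)
  finally have dvd: "(\<Prod>j\<in>?T. [:- root j, 1:]) ^ m dvd line_restrict u w f" .
  have "degree ((\<Prod>j\<in>?T. [:- root j, 1:]) ^ m) = m * (card S - 1)"
    using degree_prod_linear[of root ?T] fin S(2)
    by (subst degree_power_eq) (auto simp: card_Diff_singleton)
  then have "line_restrict u w f = 0"
    using dvd_imp_degree_le[OF dvd] degree_restrict_le[OF f(1), of u w] f(2) by linarith
  then show ?thesis by (rule dvd_of_restrict_eq_0[OF f(1)])
qed

lemma linear_form_prime:
  assumes "homogeneous 1 (p :: 'a::field poly3)" "p \<noteq> 0"
  shows "prime_elem p"
  by (rule line_frame_exists_base[OF assms]) (rule line_frame.prime)

lemma prime_elem_dvd_prodD: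
  assumes "prime_elem p" "p dvd prod f A"
  shows "\<exists>a\<in>A. p dvd f a"
  using assms(2)
proof (induction A rule: infinite_finite_induct)
  case (insert a A)
  then show ?case using prime_elem_dvd_multD[OF assms(1)] by auto
qed (use assms(1) in \<open>auto dest: prime_elem_not_unit\<close>)

text \<open>Each \<open>g i\<close> is prime and divides no other \<open>g j\<close>, so it still
  divides the quotient by the lines already removed. Each division costs one order, at points of
  that line alone.\<close>

lemma divide_by_lines:
  assumes S: "distinct_lines S g" and A: "A \<subseteq> S" and f: "homogeneous d f" "f \<noteq> 0"
    and dvd: "\<And>i. i \<in> A \<Longrightarrow> g i dvd f"
  shows "\<exists>h. f = prod g A * h \<and> card A \<le> d \<and> homogeneous (d - card A) h \<and>
    (\<forall>v m. vanishes_to_order v m f \<longrightarrow> vanishes_to_order v (m - point_mult A g v) h)"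
  using finite_subset[OF A distinct_linesD(1)[OF S]] A dvd
proof (induction A)
  case empty
  then show ?case using f by (simp add: point_mult_def)
next
  case (insert i A)
  then obtain h where h: "f = prod g A * h" "card A \<le> d" "homogeneous (d - card A) h"
    and van: "\<And>v m. vanishes_to_order v m f \<Longrightarrow> vanishes_to_order v (m - point_mult A g v) h"
    by (metis insert_subset insertCI)
  note gi = distinct_linesD(2,3)[OF S, of i]
  have i: "i \<in> S" using insert.prems by auto
  have "\<not> g i dvd prod g A"
    using prime_elem_dvd_prodD[OF linear_form_prime[OF gi[OF i]]] distinct_linesD(4)[OF S i] insert by blast
  moreover have "g i dvd prod g A * h" using insert.prems h(1) by auto
  ultimately have "g i dvd h"
    using prime_elem_dvd_multD[OF linear_form_prime[OF gi[OF i]]] by blast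
  moreover have "h \<noteq> 0" using h(1) f(2) by auto
  ultimately obtain h' where h': "h = g i * h'" "1 \<le> d - card A" "homogeneous (d - card A - 1) h'"
    using homogeneous_dvd[OF gi[OF i] h(3)] by metis
  have "vanishes_to_order v (m - point_mult (insert i A) g v) h'" if "vanishes_to_order v m f" for v m
  proof -
    have "vanishes_to_order v (m - point_mult A g v) (g i * h')" using van[OF that] h'(1) by simp
    from vanishes_to_order_divide_linear_form[OF gi[OF i] this] show ?thesis
      using insert.hyps by (auto simp: point_mult_insert split: if_splits)
  qed
  moreover have "f = prod g (insert i A) * h'" using h(1) h'(1) insert.hyps by (simp add: mult_ac)
  moreover have "card (insert i A) \<le> d" "homogeneous (d - card (insert i A)) h'"
    using h'(2,3) insert.hyps by simp_all
  ultimately show ?case by blast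
qed

lemma fat_points_degree_step:
  fixes g :: "'i \<Rightarrow> 'a::field_char_0 poly3"
  assumes S: "distinct_lines S g" and f: "homogeneous d f" "f \<noteq> 0" "d < m * (card S - 1)"
    and van: "\<And>v. v \<noteq> 0 \<Longrightarrow> vanishes_to_order v (m * (point_mult S g v - 1)) f"
  obtains h where "h \<noteq> 0" "card S \<le> d" "homogeneous (d - card S) h"
    "\<And>v. v \<noteq> 0 \<Longrightarrow> vanishes_to_order v ((m - 2) * (point_mult S g v - 1)) h"
proof -
  have "g i dvd f" if "i \<in> S" for i
    by (rule fat_points_dvd[OF S that f(1,3) van])
  from divide_by_lines[OF S order_refl f(1,2) this]
  obtain h where h: "f = prod g S * h" "card S \<le> d" "homogeneous (d - card S) h"
    and hv: "\<And>v m. vanishes_to_order v m f \<Longrightarrow> vanishes_to_order v (m - point_mult S g v) h"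
    by blast
  \<comment> \<open>For p <= 1 or m <= 2 the left side is 0; otherwise p <= 2 (p - 1).\<close>
  have le: "(m - 2) * (p - 1) \<le> m * (p - 1) - p" for p :: nat
  proof (cases p)
    case (Suc q)
    show ?thesis
    proof (cases "m \<ge> 2")
      case True
      then obtain t where "m = 2 + t" using le_Suc_ex by blast
      then show ?thesis using Suc by (cases q) simp_all
    qed simp
  qed simp
  show ?thesis
  proof (rule that[OF _ h(2,3)])
    show "h \<noteq> 0" using h(1) f(2) by auto
    show "vanishes_to_order v ((m - 2) * (point_mult S g v - 1)) h" if "v \<noteq> 0" for v
      by (rule vanishes_to_order_mono[OF hv[OF van[OF that]] le])
  qed
qed

lemma fat_points_degree_even:
  fixes g :: "'i \<Rightarrow> 'a::field_char_0 poly3"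
  assumes S: "distinct_lines S g" "2 \<le> card S"
  shows "homogeneous d f \<Longrightarrow> f \<noteq> 0 \<Longrightarrow>
    (\<And>v. v \<noteq> 0 \<Longrightarrow> vanishes_to_order v (2 * r * (point_mult S g v - 1)) f) \<Longrightarrow> r * card S \<le> d"
proof (induction r arbitrary: d f)
  case (Suc r)
  show ?case
  proof (cases "d < 2 * Suc r * (card S - 1)")
    case True
    obtain h where h: "h \<noteq> 0" "card S \<le> d" "homogeneous (d - card S) h"
      "\<And>v. v \<noteq> 0 \<Longrightarrow> vanishes_to_order v ((2 * Suc r - 2) * (point_mult S g v - 1)) h"
      using fat_points_degree_step[OF S(1) Suc.prems(1,2) True Suc.prems(3)] by blast
    have "2 * Suc r - 2 = 2 * r" by simp
    then have "r * card S \<le> d - card S" using Suc.IH[OF h(3,1)] h(4) by simp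
    then show ?thesis using h(2) by simp
  next
    case False
    \<comment> \<open>With n = card S, here d >= 2 (r + 1)(n - 1), and 2 (n - 1) >= n since n >=
      2.\<close>
    obtain t where "card S = 2 + t" using S(2) le_Suc_ex by blast
    then show ?thesis using False by (simp add: algebra_simps)
  qed
qed simp

text \<open>The bound is (r + 1) n - 1. The loss of one comes from r = 0, where the threshold m (n -
  1) is n - 1; \<open>Suc d\<close> avoids a truncated subtraction.\<close>

lemma fat_points_degree_odd:
  fixes g :: "'i \<Rightarrow> 'a::field_char_0 poly3"
  assumes S: "distinct_lines S g" "2 \<le> card S"
  shows "homogeneous d f \<Longrightarrow> f \<noteq> 0 \<Longrightarrow>
    (\<And>v. v \<noteq> 0 \<Longrightarrow> vanishes_to_order v ((2 * r + 1) * (point_mult S g v - 1)) f) \<Longrightarrow>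
    Suc r * card S \<le> Suc d"
proof (induction r arbitrary: d f)
  case 0
  show ?case
  proof (cases "d < (2 * 0 + 1) * (card S - 1)")
    case True
    then obtain h where "card S \<le> d"
      using fat_points_degree_step[OF S(1) 0(1,2) True 0(3)] by blast
    then show ?thesis by simp
  qed simp
next
  case (Suc r)
  show ?case
  proof (cases "d < (2 * Suc r + 1) * (card S - 1)")
    case True
    obtain h where h: "h \<noteq> 0" "card S \<le> d" "homogeneous (d - card S) h"
      "\<And>v. v \<noteq> 0 \<Longrightarrow> vanishes_to_order v ((2 * Suc r + 1 - 2) * (point_mult S g v - 1)) h"
      using fat_points_degree_step[OF S(1) Suc.prems(1,2) True Suc.prems(3)] by blast
    have "2 * Suc r + 1 - 2 = 2 * r + 1" by simp
    then have "Suc r * card S \<le> Suc (d - card S)" using Suc.IH[OF h(3,1)] h(4) by simp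
    then show ?thesis using h(2) by simp
  next
    case False
    obtain t where "card S = 2 + t" using S(2) le_Suc_ex by blast
    then show ?thesis using False by (simp add: algebra_simps)
  qed
qed

subsection \<open>Principal primes generated by linear forms\<close>

lemma linear_form_primeideal:
  assumes "homogeneous 1 (p :: 'a::field poly3)" "p \<noteq> 0"
  shows "primeideal {x. p dvd x} polyR"
proof (rule primeidealI)
  have p: "prime_elem p" by (rule linear_form_prime[OF assms])
  show "ideal {x. p dvd x} polyR" by (simp add: ideal_type_iff)
  show "cring (polyR :: 'a poly3 ring)" by (rule cring_from_type_algebra)
  show "carrier polyR \<noteq> {x. p dvd x}"
    using prime_elem_not_unit[OF p] by (auto simp: ring_of_type_algebra_def)
  show "a \<in> {x. p dvd x} \<or> b \<in> {x. p dvd x}" if "a \<otimes>\<^bsub>polyR\<^esub> b \<in> {x. p dvd x}" for a b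
    using that prime_elem_dvd_multD[OF p] by (auto simp: ring_of_type_algebra_def)
qed

text \<open>A nonzero element of the smaller prime could be divided by \<open>p\<close> indefinitely.\<close>

lemma primeideal_below_linear_form:
  assumes p: "homogeneous 1 (p :: 'a::field poly3)" "p \<noteq> 0"
    and Q: "primeideal Q polyR" "Q \<subset> {x. p dvd x}"
  shows "Q \<subseteq> {0}"
proof -
  have ideal: "ideal Q polyR" using Q(1) by (rule primeideal.axioms)
  have "p \<notin> Q"
    using Q(2) ideal_type_mult[OF ideal, of p] by (auto simp: dvd_def mult.commute)
  have "x = 0" if "x \<in> Q" for x
    using that
  proof (induction "degree (grading x)" arbitrary: x rule: less_induct)
    case less
    show ?case
    proof (rule ccontr)
      assume "x \<noteq> 0"
      obtain h where h: "x = p * h" using less.prems Q(2) by auto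
      then have "h \<in> Q"
        using less.prems \<open>p \<notin> Q\<close> primeideal.I_prime[OF Q(1), of p h] by (auto simp: ring_of_type_algebra_def)
      have "h \<noteq> 0" using \<open>x \<noteq> 0\<close> h by auto
      then have "grading h \<noteq> 0" using sum_coeff_grading[of h] by auto
      then have "degree (grading x) = 1 + degree (grading h)"
        using p by (simp add: h grading.mult degree_mult_eq grading_homogeneous degree_monom_eq)
      then show False using less.hyps[OF _ \<open>h \<in> Q\<close>] \<open>h \<noteq> 0\<close> by simp
    qed
  qed
  then show ?thesis by auto
qed

lemma prime_height_linear_form:
  assumes p: "homogeneous 1 (p :: 'a::field poly3)" "p \<noteq> 0"
  shows "prime_height polyR {x. p dvd x} \<le> 1"
  unfolding prime_height_def
proof (rule Sup_least)
  fix x assume "x \<in> {enat k | k. \<exists>C. (\<forall>i\<le>k. primeideal (C i) (polyR :: 'a poly3 ring)) \<and>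
    (\<forall>i<k. C i \<subset> C (Suc i)) \<and> C k = {x. p dvd x}}"
  then obtain k C where x: "x = enat k" and C: "\<And>i. i \<le> k \<Longrightarrow> primeideal (C i) (polyR :: 'a poly3 ring)"
    "\<And>i. i < k \<Longrightarrow> C i \<subset> C (Suc i)" "C k = {x. p dvd x}" by auto
  have "k \<le> 1"
  proof (rule ccontr)
    assume "\<not> k \<le> 1"
    then obtain t where k: "k = Suc (Suc t)" by (metis One_nat_def le_eq_less_or_eq less_Suc0 not0_implies_Suc zero_le)
    have "C (Suc t) \<subset> {x. p dvd x}" using C(2)[of "Suc t"] C(3) k by simp
    then have "C (Suc t) \<subseteq> {0}" using primeideal_below_linear_form[OF p C(1)] k by simp
    moreover have "0 \<in> C t"
      using primeideal.axioms(1)[OF C(1)[of t]] k by (simp add: ideal_type_zero)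
    ultimately show False using C(2)[of t] k by auto
  qed
  then show "x \<le> 1" by (simp add: x one_enat_def)
qed

text \<open>Lets the height hypothesis exclude fewer than two lines, since the generators would then
  all be multiples of one linear form.\<close>

lemma ideal_height_linear_form:
  assumes "homogeneous 1 (p :: 'a::field poly3)" "p \<noteq> 0" "\<And>x. x \<in> E \<Longrightarrow> p dvd x"
  shows "ideal_height polyR (Idl\<^bsub>polyR\<^esub> E) \<le> 1"
proof -
  have prime: "primeideal {x. p dvd x} polyR" by (rule linear_form_primeideal[OF assms(1,2)])
  have "Idl\<^bsub>polyR\<^esub> E \<subseteq> {x. p dvd x}"
    using assms(3) primeideal.axioms(1)[OF prime] by (intro genideal_type_subset) auto
  then have "ideal_height polyR (Idl\<^bsub>polyR\<^esub> E) \<le> prime_height polyR {x. p dvd x}"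
    unfolding ideal_height_def using prime by (intro Inf_lower) auto
  then show ?thesis using prime_height_linear_form[OF assms(1,2)] by (rule order_trans)
qed

subsection \<open>Points of the projective plane\<close>

lemma poly_eval_scale:
  assumes "homogeneous d f"
  shows "poly_eval f (c *s v) = c ^ d * poly_eval f v"
  using psub_homogeneous[OF assms, of "\<lambda>x. x" c "\<lambda>i. v $ i"] by (simp add: poly_eval_eq_psub)

lemma zero_locus_mem:
  assumes "homogeneous d f" "P \<in> proj_plane" "v \<in> P"
  shows "P \<in> zero_locus f \<longleftrightarrow> poly_eval f v = 0"
proof -
  obtain v0 where P: "P = {c *s v0 | c. c \<noteq> 0}" using assms(2) by (auto simp: proj_plane_def)
  then obtain c where c: "v = c *s v0" "c \<noteq> 0" using assms(3) by auto
  show ?thesis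
    using assms(2) c P by (auto simp: zero_locus_def vanishes_at_def poly_eval_scale[OF assms(1)])
qed

lemma poly_eval_homogeneous_0:
  assumes "homogeneous 0 (h :: 'a::field poly3)" "h \<noteq> 0"
  shows "poly_eval h v \<noteq> 0"
proof -
  have "m = 0" if "m \<in> Poly_Mapping.keys h" for m
    using homogeneousD[OF assms(1) that] by (intro poly_mapping_eqI) (simp add: mon_degree_def)
  then have "Poly_Mapping.keys h = {0}" using assms(2) by (metis keys_eq_empty is_singletonI' is_singleton_the_elem singletonD singletonI)
  then show ?thesis by (simp add: poly_eval_def in_keys_iff[symmetric])
qed

text \<open>The quotient is a nonzero constant. Contrapositively, lines with different zero loci
  have forms that do not divide each other.\<close>

lemma zero_locus_dvd:
  assumes "homogeneous 1 p" "p \<noteq> 0" "homogeneous 1 q" "q \<noteq> 0" "p dvd (q :: 'a::field poly3)"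
  shows "zero_locus p = zero_locus q"
proof -
  obtain h where h: "q = p * h" "homogeneous 0 h"
    using homogeneous_dvd[OF assms] by (metis diff_self_eq_0)
  then have "poly_eval h v \<noteq> 0" for v using assms(4) poly_eval_homogeneous_0 by auto
  then show ?thesis by (simp add: zero_locus_def vanishes_at_def h(1) evaluation.mult)
qed

text \<open>Grading followed by Taylor expansion of each coefficient is a homomorphism sending the
  homogeneous generators to multiples of the constant t. Divisibility by t^k is then read off
  coefficientwise, so every homogeneous component inherits the order.\<close>

lemma point_ideal_power_vanishes:
  assumes "f \<in> idpow (point_ideal P) k" "v \<in> P"
  shows "vanishes_to_order v k (coeff (grading f) d)"
proof -
  let ?\<psi> = "\<lambda>f. map_poly (taylor v) (grading f)"
  have \<psi>: "comm_ring_morphism ?\<psi>"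
    by (rule comm_ring_morphism_comp[OF taylor.map_poly grading.comm_ring_morphism_axioms])
  have "[:[:0, 1:]:] dvd ?\<psi> x" if "x \<in> point_ideal P" for x
  proof (rule genideal_dvd[OF \<psi> _ that[unfolded point_ideal_def]])
    fix x assume "x \<in> {f. (\<exists>d. homogeneous d f) \<and> vanishes_at f P}"
    then obtain e where x: "homogeneous e x" "poly_eval x v = 0"
      using assms(2) by (auto simp: vanishes_at_def)
    have "poly (taylor v x) 0 = Poly_Mapping.single 0 (poly_eval x v)"
      by (simp add: taylor_def morphism_psub[OF comm_ring_morphism_poly] single_0_poly_eval)
    then have "[:- 0, 1:] dvd taylor v x" by (subst poly_eq_0_iff_dvd[symmetric]) (simp add: x)
    then show "[:[:0, 1:]:] dvd ?\<psi> x"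
      by (simp add: grading_homogeneous[OF x(1)] map_poly_monom taylor.zero const_poly_dvd_iff)
  qed
  from idpow_dvd[OF \<psi> this assms(1)] have "[:[:0, 1:] ^ k:] dvd ?\<psi> f"
    by (simp add: poly_const_pow)
  then show ?thesis
    by (auto simp: const_poly_dvd_iff coeff_map_poly taylor.zero vanishes_to_order_def)
qed

text \<open>\<open>mult_at\<close> counts lines as point sets and \<open>point_mult\<close> counts
  indices; injectivity identifies the two at singular points. Elsewhere the required order is
  0.\<close>

lemma symbolic_power_vanishes:
  fixes l :: "nat \<Rightarrow> 'a::field poly3"
  assumes l: "\<And>i. i \<in> {1..n} \<Longrightarrow> homogeneous 1 (l i)"
    and inj: "inj_on (\<lambda>i. zero_locus (l i)) {1..n}"
    and f: "f \<in> symbolic_power ((\<lambda>i. zero_locus (l i)) ` {1..n}) m" and v: "v \<noteq> 0"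
  shows "vanishes_to_order v (m * (point_mult {1..n} l v - 1)) (coeff (grading f) d)"
proof (cases "point_mult {1..n} l v \<ge> 2")
  case True
  let ?A = "(\<lambda>i. zero_locus (l i)) ` {1..n}"
  define P where "P = {c *s v | c. c \<noteq> 0}"
  have P: "P \<in> proj_plane" "v \<in> P"
    using v by (auto simp: P_def proj_plane_def intro: exI[of _ 1])
  have "{L \<in> ?A. P \<in> L} = (\<lambda>i. zero_locus (l i)) ` {i \<in> {1..n}. poly_eval (l i) v = 0}"
    using zero_locus_mem[OF l P] by auto
  moreover have "inj_on (\<lambda>i. zero_locus (l i)) {i \<in> {1..n}. poly_eval (l i) v = 0}"
    by (rule inj_on_subset[OF inj]) auto
  ultimately have "mult_at ?A P = point_mult {1..n} l v"
    unfolding mult_at_def point_mult_def by (simp only: card_image)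
  moreover from this have "P \<in> singular_points ?A"
    using P(1) True by (simp add: singular_points_def)
  ultimately have "f \<in> idpow (point_ideal P) (m * (point_mult {1..n} l v - 1))"
    using f by (auto simp: symbolic_power_def idpow_def)
  then show ?thesis by (rule point_ideal_power_vanishes[OF _ P(2)])
next
  case False
  then have "point_mult {1..n} l v - 1 = 0" by simp
  then show ?thesis by simp
qed

section \<open>The two containments\<close>

theorem corollary3p4:
  fixes n r :: nat
    and l :: "nat \<Rightarrow> 'a::field_char_0 poly3"
    and A :: "'a point set set"
    and I M :: "'a poly3 set"
  assumes "\<And>i. i \<in> {1..n} \<Longrightarrow> homogeneous 1 (l i) \<and> l i \<noteq> 0"
    and "inj_on (\<lambda>i. zero_locus (l i)) {1..n}"
    and "A = (\<lambda>i. zero_locus (l i)) ` {1..n}"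
    and "ideal_height polyR (Idl\<^bsub>polyR\<^esub> (l ` {1..n})) = 3"
    and "I = fold_product_ideal n l"
    and "M = irrelevant_ideal"
    and "r \<ge> 1"
  shows "symbolic_power A (2 * r - 1) \<subseteq> ideal_power M (r - 1) \<cdot>\<^bsub>polyR\<^esub> ideal_power I r \<and>
         symbolic_power A (2 * r) \<subseteq> ideal_power M r \<cdot>\<^bsub>polyR\<^esub> ideal_power I r"
proof -
  let ?S = "{1..n}"
  have lin: "homogeneous 1 (l i)" "l i \<noteq> 0" if "i \<in> ?S" for i
    using assms(1)[OF that] by auto
  have S: "distinct_lines ?S l"
    unfolding distinct_lines_def
  proof (intro conjI ballI impI notI)
    fix i j assume ij: "i \<in> ?S" "j \<in> ?S" "i \<noteq> j" "l i dvd l j"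
    then have "zero_locus (l i) = zero_locus (l j)"
      by (intro zero_locus_dvd lin)
    then show False using inj_onD[OF assms(2)] ij by metis
  qed (use lin in auto)
  have n: "2 \<le> card ?S"
  proof (rule ccontr)
    assume "\<not> 2 \<le> card ?S"
    then consider "n = 0" | "n = 1" by force
    then have "ideal_height polyR (Idl\<^bsub>polyR\<^esub> (l ` ?S)) \<le> 1"
    proof cases
      case 1
      \<comment> \<open>With no lines there are no generators, so any nonzero linear form divides
        all of them.\<close>
      have "Var 1 \<noteq> (0 :: 'a poly3)"
      proof
        assume "Var 1 = (0 :: 'a poly3)"
        then have "poly_eval (Var 1) (1 :: 'a ^ 3) = 0" by (simp only: evaluation.zero)
        then show False by simp
      qed
      then show ?thesis using 1 by (intro ideal_height_linear_form[OF homogeneous_Var]) auto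
    next
      case 2
      then show ?thesis using lin[of 1] by (intro ideal_height_linear_form) auto
    qed
    then show False using assms(4) by (simp add: one_enat_def numeral_eq_enat)
  qed
  then have n': "?S \<noteq> {}" by auto
  have I: "I = fold_ideal ?S l" by (simp add: assms(5) fold_product_ideal_def fold_ideal_def)
  \<comment> \<open>\<open>deg\<close> supplies the surplus \<open>e\<close> over r(n - 1) for each
    nonzero homogeneous component, and r <= m weakens the orders to those needed for I^r.\<close>
  have main: "symbolic_power A m \<subseteq> ideal_power M e \<cdot>\<^bsub>polyR\<^esub> ideal_power I r"
    if rm: "r \<le> m" and deg: "\<And>d f. homogeneous d f \<Longrightarrow> f \<noteq> 0 \<Longrightarrow>
      (\<And>v. v \<noteq> 0 \<Longrightarrow> vanishes_to_order v (m * (point_mult ?S l v - 1)) f) \<Longrightarrow> r * (card ?S - 1) + e \<le> d" for m e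
  proof
    fix f assume f: "f \<in> symbolic_power A m"
    have "coeff (grading f) d \<in> irr_fold e r ?S l" for d
    proof (cases "coeff (grading f) d = 0")
      case True
      then show ?thesis by (simp add: ideal_type_zero[OF irr_fold_ideal])
    next
      case False
      have van: "vanishes_to_order v (m * (point_mult ?S l v - 1)) (coeff (grading f) d)" if "v \<noteq> 0" for v
        using symbolic_power_vanishes[OF lin(1) assms(2) f[unfolded assms(3)] that] .
      have d: "r * (card ?S - 1) + e \<le> d"
        by (rule deg[OF homogeneous_coeff_grading False van])
      show ?thesis
      proof (rule fat_points_in_power[OF S n'])
        show "e \<le> d - r * (card ?S - 1)" using d by linarith
        show "homogeneous (r * (card ?S - 1) + (d - r * (card ?S - 1))) (coeff (grading f) d)"
          using d homogeneous_coeff_grading[of d f] by simp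
        show "vanishes_to_order v (r * (point_mult ?S l v - 1)) (coeff (grading f) d)" if "v \<noteq> 0" for v
          by (rule vanishes_to_order_mono[OF van[OF that]]) (simp add: rm)
      qed
    qed
    then have "(\<Sum>d\<le>degree (grading f). coeff (grading f) d) \<in> irr_fold e r ?S l"
      by (intro ideal_type_sum[OF irr_fold_ideal])
    then show "f \<in> ideal_power M e \<cdot>\<^bsub>polyR\<^esub> ideal_power I r"
      by (simp add: sum_coeff_grading I assms(6) idpow_def)
  qed
  obtain t where t: "card ?S = 2 + t" using le_Suc_ex[OF n] by blast
  obtain q where q: "r = Suc q" using assms(7) by (cases r) auto
  show ?thesis
  proof
    show "symbolic_power A (2 * r - 1) \<subseteq> ideal_power M (r - 1) \<cdot>\<^bsub>polyR\<^esub> ideal_power I r"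
    proof (rule main)
      fix d f
      assume "homogeneous d f" "f \<noteq> 0"
        and "\<And>v. v \<noteq> 0 \<Longrightarrow> vanishes_to_order v ((2 * r - 1) * (point_mult ?S l v - 1)) f"
      then have "Suc q * card ?S \<le> Suc d"
        by (intro fat_points_degree_odd[OF S n, of d f q]) (auto simp: q)
      \<comment> \<open>The odd bound is r n - 1 = r (n - 1) + (r - 1), as r = q + 1.\<close>
      then show "r * (card ?S - 1) + (r - 1) \<le> d" unfolding t by (simp add: q)
    qed (simp add: q)
    show "symbolic_power A (2 * r) \<subseteq> ideal_power M r \<cdot>\<^bsub>polyR\<^esub> ideal_power I r"
    proof (rule main)
      fix d f
      assume "homogeneous d f" "f \<noteq> 0"
        and "\<And>v. v \<noteq> 0 \<Longrightarrow> vanishes_to_order v (2 * r * (point_mult ?S l v - 1)) f"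
      then have "r * card ?S \<le> d" by (rule fat_points_degree_even[OF S n])
      then show "r * (card ?S - 1) + r \<le> d" unfolding t by simp
    qed simp
  qed
qed

end
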